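(* Let $x$ and $y$ be representations of a countable set $A$. Suppose there is a computable function $f$ defined on $x(A)$ (with $f(x(A))=y(A)$) such that $y=f\circ x$, and suppose that $x(A)$ is computationally enumerable. Then there is also a computable function $g$ defined on $y(A)$ such that $x=g\circ y$; i.e., $x$ and $y$ are transformationally equivalent.
   Context: $\mathbb{T}$ denotes the set of tapes over a fixed finite alphabet with finitely many non-blank symbols. For $Q\subseteq\mathbb{T}$, a function with domain $Q$ and values in $\mathbb{T}$ is computable if some Turing machine (TM), on every input $\tau\in Q$, halts with output equal to the function's value (nothing is required outside $Q$). A set $Q\subseteq\mathbb{T}$ is computationally enumerable (c.e.) if there is a TM that halts with a fixed "yes" tape on every $\tau\in Q$ and does not halt on any $\tau\notin Q$ (equivalently, there are a computable $h:Q\to Q$ and $\tau_0\in Q$ with every element of $Q$ equal to $h^i(\tau_0)$ for some $i\in\mathbb{N}$). A representation of a set $A$ is an injective function $A\to\mathbb{T}$. For representations $x,y$ of $A$, $x$ is transformable into $y$ if $y\circ x^{-1}$ (defined on $x(A)$) is computable; $x$ and $y$ are transformationally equivalent if each is transformable into the other. Standing assumptions: there is a fixed tape pairing bijection $\langle\cdot,\cdot\rangle:\mathbb{T}\times\mathbb{T}\to\mathbb{T}$ for which duplication, swap, projections and partial application of computable functions are computable, and there is a TM deciding, on input $\langle\tau,\tau'\rangle$, whether $\tau=\tau'$. *)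

theory Defs
  imports Main "HOL-Library.Countable_Set"
begin

text \<open>
  The fixed finite alphabet is \<open>'s option\<close>, for a finite type \<open>'s\<close> of non-blank symbols;
  \<open>None\<close> is the blank. A tape is two-way infinite with finitely many non-blank cells.
\<close>

typedef 's tape = "{t :: int \<Rightarrow> 's option. finite (dom t)}"
  morphisms cells Tape
  by (rule exI[of _ Map.empty]) simp

text \<open>
  Machines are one-tape Turing machines in the sense of the usual tuple
  \<open>(Q, \<Sigma>, \<Gamma>, \<delta>)\<close>: the work alphabet contains the input alphabet \<open>'s option\<close>
  (constructor \<open>Sym\<close>), a separate work blank \<open>Void\<close>, and auxiliary symbols, of which a given
  machine uses only finitely many.

  \<open>Void\<close> has to differ from the blank \<open>Sym None\<close> of the tapes. A tape may contain
  arbitrarily long gaps, so a machine unable to see where the used part of its tape ends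
  could never know that it has read the whole input: a halting run depends on a finite window
  only and leaves everything outside it in place. Then no machine could decide anything with a
  fixed answer tape on all tapes, nor copy or compare tapes, and only the empty set would be
  computationally enumerable.
\<close>

datatype 's work_symbol = Void | Sym "'s option" | Aux nat

datatype move = MoveLeft | Stay | MoveRight

fun offset :: "move \<Rightarrow> int" where
  "offset MoveLeft = -1"
| "offset Stay = 0"
| "offset MoveRight = 1"

text \<open>
  A machine is a finite partial table \<open>(state, scanned symbol) \<mapsto> (state, written symbol, move)\<close>.
  The start state is 0, and the machine halts when no entry applies.
\<close>

type_synonym 's machine =
  "nat \<times> 's work_symbol \<Rightarrow> (nat \<times> 's work_symbol \<times> move) option"

definition turing_machine :: "'s machine \<Rightarrow> bool" where
  "turing_machine M \<longleftrightarrow> finite (dom M)"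

text \<open>A configuration consists of the state, the head position and the work tape.\<close>

type_synonym 's config = "nat \<times> int \<times> (int \<Rightarrow> 's work_symbol)"

fun step :: "'s machine \<Rightarrow> 's config \<Rightarrow> 's config option" where
  "step M (q, h, w) =
     (case M (q, w h) of
        None \<Rightarrow> None
      | Some (q', c, d) \<Rightarrow> Some (q', h + offset d, w(h := c)))"

definition halts_in :: "'s machine \<Rightarrow> 's config \<Rightarrow> 's config \<Rightarrow> bool" where
  "halts_in M c c' \<longleftrightarrow> (\<lambda>d d'. step M d = Some d')\<^sup>*\<^sup>* c c' \<and> step M c' = None"

text \<open>
  The work tape holding \<open>t\<close>: the least interval that contains cell 0 and all non-blank cells
  carries the symbols of \<open>t\<close> (inner blanks included), and everything outside is \<open>Void\<close>.
\<close>

definition load :: "'s tape \<Rightarrow> int \<Rightarrow> 's work_symbol" where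
  "load t i =
     (let S = insert 0 (dom (cells t)) in
      if (\<exists>a\<in>S. \<exists>b\<in>S. a \<le> i \<and> i \<le> b) then Sym (cells t i) else Void)"

text \<open>Input and output follow the same convention, with the head on cell 0.\<close>

definition outputs :: "'s machine \<Rightarrow> 's tape \<Rightarrow> 's tape \<Rightarrow> bool" where
  "outputs M t t' \<longleftrightarrow> (\<exists>q. halts_in M (0, 0, load t) (q, 0, load t'))"

definition halts_on :: "'s machine \<Rightarrow> 's tape \<Rightarrow> bool" where
  "halts_on M t \<longleftrightarrow> (\<exists>c. halts_in M (0, 0, load t) c)"

definition computable_on :: "'s tape set \<Rightarrow> ('s tape \<Rightarrow> 's tape) \<Rightarrow> bool" where
  "computable_on Q f \<longleftrightarrow> (\<exists>M. turing_machine M \<and> (\<forall>t\<in>Q. outputs M t (f t)))"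

definition comp_enumerable :: "'s tape set \<Rightarrow> bool" where
  "comp_enumerable Q \<longleftrightarrow>
     (\<exists>M yes. turing_machine M \<and> (\<forall>t\<in>Q. outputs M t yes) \<and> (\<forall>t. t \<notin> Q \<longrightarrow> \<not> halts_on M t))"

text \<open>
  A tape pairing, for which duplication, swapping, both projections, and the application of a
  computable function to one component are computable, and equality of the components is
  decidable.
\<close>

definition tape_pairing :: "('s tape \<times> 's tape \<Rightarrow> 's tape) \<Rightarrow> bool" where
  "tape_pairing pr \<longleftrightarrow>
     bij pr \<and>
     computable_on UNIV (\<lambda>t. pr (t, t)) \<and>
     computable_on UNIV (pr \<circ> prod.swap \<circ> inv pr) \<and>
     computable_on UNIV (fst \<circ> inv pr) \<and>
     computable_on UNIV (snd \<circ> inv pr) \<and>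
     (\<forall>Q f. computable_on Q f \<longrightarrow>
        computable_on (pr ` (Q \<times> UNIV)) (pr \<circ> map_prod f id \<circ> inv pr)) \<and>
     (\<exists>M yes no. turing_machine M \<and> yes \<noteq> no \<and>
        (\<forall>t t'. outputs M (pr (t, t')) (if t = t' then yes else no)))"

definition representation :: "'a set \<Rightarrow> ('a \<Rightarrow> 's tape) \<Rightarrow> bool" where
  "representation A x \<longleftrightarrow> inj_on x A"

definition transformable :: "'a set \<Rightarrow> ('a \<Rightarrow> 's tape) \<Rightarrow> ('a \<Rightarrow> 's tape) \<Rightarrow> bool" where
  "transformable A x y \<longleftrightarrow> computable_on (x ` A) (y \<circ> inv_into A x)"

definition transf_equivalent :: "'a set \<Rightarrow> ('a \<Rightarrow> 's tape) \<Rightarrow> ('a \<Rightarrow> 's tape) \<Rightarrow> bool" where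
  "transf_equivalent A x y \<longleftrightarrow> transformable A x y \<and> transformable A y x"

end

theory Submission imports Defs "HOL-Library.FuncSet" begin

text \<open>
  To invert \<open>f\<close> on \<open>y ` A\<close>, search through all pairs of a tape \<open>t\<close> and a time bound \<open>n\<close>: run the
  enumerating machine on \<open>t\<close> for \<open>n\<close> steps; if it has halted, then \<open>t \<in> x ` A\<close>, so that the
  machine for \<open>f\<close> halts on \<open>t\<close> as well, and its output can be compared with the input. The search
  meets the code of \<open>x a\<close> with a sufficient bound, and by injectivity of \<open>y\<close> it returns nothing else.

  The search is written as a structured program over finitely many stacks. Such a program is
  compiled to a single Turing machine, whose tape cells carry one track for each pair of stacks.
  One list serves as both tape and time bound: it encodes the tape, possibly with
  redundant symbols, and its length is the bound.
\<close>

section \<open>Stack programs\<close>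

text \<open>Stacks are chosen because all data of the search then fit into one finite alphabet: the
  states of the two simulated machines become symbols \<open>Aux q\<close>, a tape becomes two
  stacks around its head, and the loop conditions are the emptiness of certain stacks. A Turing
  machine can hold a fixed number of such stacks side by side.

  One list can serve as tape and bound because codes can be padded: on a blank tape the instruction
  to move right changes nothing, so every tape has codes beyond any given length. A single counter
  through all lists therefore dovetails over tapes and times.

  Computability on a set asks nothing outside the set. So only terminating runs are ever followed: a
  derivation of a program is turned into a run of the compiled machine, and the behaviour of the
  search on tapes that are not values of \<open>y\<close> is never analysed. The delicate point is
  inside the search, where the machine for \<open>f\<close> is run without a bound; this is safe
  only because acceptance has been established before.\<close>

datatype ('k, 'e) com =
    Skip
  | Push "'k \<times> bool" 'e
  | Pop "'k \<times> bool" "'e option \<Rightarrow> ('k, 'e) com"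
  | Drain "'k \<times> bool" "'e \<Rightarrow> ('k, 'e) com"
  | Seq "('k, 'e) com" "('k, 'e) com"

type_synonym ('k, 'e) store = "'k \<times> bool \<Rightarrow> 'e list"

definition peek :: "'e list \<Rightarrow> 'e option" where
  "peek l = (case l of [] \<Rightarrow> None | e # _ \<Rightarrow> Some e)"

lemma peek_simps [simp]: "peek [] = None" "peek (e # l) = Some e"
  by (simp_all add: peek_def)

text \<open>\<open>Drain_Cons\<close> resumes the loop in whatever store the body has left. A body
  that pushes onto the drained stack keeps its own loop alive, so \<open>Drain\<close> also plays
  the role of a while loop. A diverging program simply has no derivation.\<close>

inductive exec :: "('k, 'e) com \<Rightarrow> ('k, 'e) store \<Rightarrow> ('k, 'e) store \<Rightarrow> bool" where
  Skip: "exec Skip s s"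
| Push: "exec (Push k e) s (s(k := e # s k))"
| Pop: "exec (f (peek (s k))) (s(k := tl (s k))) s' \<Longrightarrow> exec (Pop k f) s s'"
| Drain_Nil: "s k = [] \<Longrightarrow> exec (Drain k f) s s"
| Drain_Cons: "s k = e # l \<Longrightarrow> exec (f e) (s(k := l)) s' \<Longrightarrow> exec (Drain k f) s' s''
    \<Longrightarrow> exec (Drain k f) s s''"
| Seq: "exec c s s' \<Longrightarrow> exec d s' s'' \<Longrightarrow> exec (Seq c d) s s''"

text \<open>\<open>Pop\<close> and \<open>Drain\<close> branch over a symbol type that may be
  infinite. As long as the stacks hold only symbols of \<open>E\<close>, no branch other than those
  examined here can be entered.\<close>

primrec pushes_in :: "'e set \<Rightarrow> ('k, 'e) com \<Rightarrow> bool" where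
  "pushes_in E Skip = True"
| "pushes_in E (Push k e) = (e \<in> E)"
| "pushes_in E (Pop k f) = (\<forall>v\<in>insert None (Some ` E). pushes_in E (f v))"
| "pushes_in E (Drain k f) = (\<forall>e\<in>E. pushes_in E (f e))"
| "pushes_in E (Seq c d) = (pushes_in E c \<and> pushes_in E d)"

definition store_in :: "'e set \<Rightarrow> ('k, 'e) store \<Rightarrow> bool" where
  "store_in E s \<longleftrightarrow> (\<forall>k. set (s k) \<subseteq> E)"

lemma store_inD: "store_in E s \<Longrightarrow> set (s k) \<subseteq> E"
  unfolding store_in_def by blast

lemma store_in_upd: "store_in E s \<Longrightarrow> set l \<subseteq> E \<Longrightarrow> store_in E (s(k := l))"
  by (auto simp: store_in_def)

lemma store_in_peek: "store_in E s \<Longrightarrow> peek (s k) \<in> insert None (Some ` E)"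
  unfolding store_in_def by (drule spec[of _ k], cases "s k") auto

lemma store_in_tl: "store_in E s \<Longrightarrow> store_in E (s(k := tl (s k)))"
  by (rule store_in_upd, assumption, unfold store_in_def, drule spec[of _ k], cases "s k") auto

section \<open>Laying out the stacks on a tape\<close>

type_synonym ('k, 'e) cell = "bool \<times> ('k \<Rightarrow> 'e option)"

definition nth_opt :: "'e list \<Rightarrow> nat \<Rightarrow> 'e option" where
  "nth_opt l n = (if n < length l then Some (l ! n) else None)"

text \<open>Stack \<open>(j, True)\<close> fills track \<open>j\<close> of the cells 0, 1, 2, ... and \<open>(j, False)\<close> that of
  the cells -1, -2, ..., bottom first. The mark on cell 0 guides the head back.\<close>

definition layout :: "('k, 'e) store \<Rightarrow> int \<Rightarrow> ('k, 'e) cell" where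
  "layout s i = (i = 0,
     \<lambda>j. if i \<ge> 0 then nth_opt (rev (s (j, True))) (nat i)
         else nth_opt (rev (s (j, False))) (nat (-1 - i)))"

definition pos :: "bool \<Rightarrow> nat \<Rightarrow> int" where
  "pos d n = (if d then int n else -1 - int n)"

definition outwards :: "bool \<Rightarrow> move" where
  "outwards d = (if d then MoveRight else MoveLeft)"

lemma pos_Suc: "pos d n + offset (outwards d) = pos d (Suc n)"
  and pos_back: "pos d (Suc n) + offset (outwards (\<not> d)) = pos d n"
  and pos_back_0: "pos False 0 + offset (outwards True) = 0"
  and pos_True_0: "pos True 0 = 0"
  by (auto simp: pos_def outwards_def)

lemma pos_inj [simp]: "pos d n = pos d' n' \<longleftrightarrow> d = d' \<and> n = n'"
  by (auto simp: pos_def)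

lemma pos_cases: obtains d n where "i = pos d n"
proof (cases "i \<ge> 0")
  case True
  then show ?thesis by (intro that[of True "nat i"]) (simp add: pos_def)
next
  case False
  then show ?thesis by (intro that[of False "nat (-1 - i)"]) (simp add: pos_def)
qed

lemma layout_pos: "layout s (pos d n) = (d \<and> n = 0, \<lambda>j. nth_opt (rev (s (j, d))) n)"
  by (auto simp: layout_def pos_def)

text \<open>With the bottom stored innermost, the height of a stack is the index of its first free
  cell. A push thus alters one track of one cell, and no other stack has to be moved.\<close>

lemma layout_push:
  "(layout s)(pos d (length (s (j, d))) :=
      (d \<and> s (j, d) = [], (\<lambda>j'. nth_opt (rev (s (j', d))) (length (s (j, d))))(j := Some e)))
   = layout (s((j, d) := e # s (j, d)))"
proof
  fix i
  obtain d' n where i: "i = pos d' n" by (rule pos_cases)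
  show "((layout s)(pos d (length (s (j, d))) :=
      (d \<and> s (j, d) = [], (\<lambda>j'. nth_opt (rev (s (j', d))) (length (s (j, d))))(j := Some e)))) i
   = layout (s((j, d) := e # s (j, d))) i"
    unfolding i by (auto simp: layout_pos nth_opt_def fun_eq_iff nth_append)
qed

lemma layout_pop:
  assumes "s (j, d) = e # l"
  shows "(layout s)(pos d (length l) :=
      (d \<and> l = [], (\<lambda>j'. nth_opt (rev (s (j', d))) (length l))(j := None)))
   = layout (s((j, d) := l))"
proof
  fix i
  obtain d' n where i: "i = pos d' n" by (rule pos_cases)
  show "((layout s)(pos d (length l) :=
      (d \<and> l = [], (\<lambda>j'. nth_opt (rev (s (j', d))) (length l))(j := None)))) i
   = layout (s((j, d) := l)) i"
    unfolding i using assms by (auto simp: layout_pos nth_opt_def fun_eq_iff nth_append)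
qed

section \<open>The control of the compiled machine\<close>

datatype 'e phase = Start | Seek | Take | Ret "'e option"

datatype ('k, 'e) control = Init | Fin | At "('k, 'e) com list" "'e phase"

fun access :: "('k, 'e) com \<Rightarrow> (('k \<times> bool) \<times> 'e option) option" where
  "access (Push k e) = Some (k, Some e)"
| "access (Pop k f) = Some (k, None)"
| "access (Drain k f) = Some (k, None)"
| "access _ = None"

fun continue :: "('k, 'e) com \<Rightarrow> ('k, 'e) com list \<Rightarrow> 'e option \<Rightarrow> ('k, 'e) com list" where
  "continue (Pop k f) cs v = f v # cs"
| "continue (Drain k f) cs v = (case v of None \<Rightarrow> cs | Some e \<Rightarrow> f e # Drain k f # cs)"
| "continue (Seq c d) cs v = c # d # cs"
| "continue _ cs v = cs"

text \<open>One stack operation is a round trip from cell 0. \<open>Seek\<close> walks outwards to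
  the first cell free on track \<open>j\<close>; a push writes there, a pop steps back inwards and
  lets \<open>Take\<close> remove the top. An empty stack is recognised by the mark: at once on the
  positive side, whose bottom is cell 0, and after the inward step on the negative side, whose
  bottom is cell -1. \<open>Ret v\<close> carries the popped symbol home in the control
  state.\<close>

fun delta :: "('k, 'e) com \<Rightarrow> ('k, 'e) control \<Rightarrow> ('k, 'e) cell
    \<Rightarrow> (('k, 'e) control \<times> ('k, 'e) cell \<times> move) option" where
  "delta c0 Init (b, g) = Some (At [c0] Start, (True, g), Stay)"
| "delta c0 Fin x = None"
| "delta c0 (At [] p) (b, g) = Some (Fin, (False, g), Stay)"
| "delta c0 (At (c # cs) p) (b, g) =
    (case access c of
       None \<Rightarrow> Some (At (continue c cs None) Start, (b, g), Stay)
     | Some ((j, d), w) \<Rightarrow> Some (case p of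
           Start \<Rightarrow> (At (c # cs) Seek, (b, g), if d then Stay else MoveLeft)
         | Seek \<Rightarrow>
             (if g j \<noteq> None then (At (c # cs) Seek, (b, g), outwards d)
              else if w \<noteq> None then (At (c # cs) (Ret None), (b, g(j := w)), Stay)
              else if b \<and> d then (At (c # cs) (Ret None), (b, g), Stay)
              else (At (c # cs) Take, (b, g), outwards (\<not> d)))
         | Take \<Rightarrow>
             (if b \<and> \<not> d then (At (c # cs) (Ret None), (b, g), Stay)
              else (At (c # cs) (Ret (g j)), (b, g(j := None)), Stay))
         | Ret v \<Rightarrow>
             (if b then (At (continue c cs v) Start, (b, g), Stay)
              else (At (c # cs) (Ret v), (b, g), outwards (\<not> d)))))"

text \<open>Structural recursion is enough for this closure: a loop body returns to the same list
  \<open>Drain k f # cs\<close>, so iterating a loop creates no new lists.\<close>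

primrec conts :: "'e set \<Rightarrow> ('k, 'e) com \<Rightarrow> ('k, 'e) com list \<Rightarrow> ('k, 'e) com list set" where
  "conts E Skip = (\<lambda>cs. {Skip # cs})"
| "conts E (Push k e) = (\<lambda>cs. {Push k e # cs})"
| "conts E (Pop k f) = (\<lambda>cs. insert (Pop k f # cs)
     (\<Union>v\<in>insert None (Some ` E). conts E (f v) cs))"
| "conts E (Drain k f) = (\<lambda>cs. insert (Drain k f # cs)
     (\<Union>e\<in>E. conts E (f e) (Drain k f # cs)))"
| "conts E (Seq c d) = (\<lambda>cs. insert (Seq c d # cs) (conts E c (d # cs) \<union> conts E d cs))"

lemma finite_conts: "finite E \<Longrightarrow> finite (conts E c cs)"
  by (induction c arbitrary: cs) auto

lemma conts_self: "c # cs \<in> conts E c cs"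
  by (cases c) auto

definition nth_void :: "'s work_symbol list \<Rightarrow> nat \<Rightarrow> 's work_symbol" where
  "nth_void l n = (if n < length l then l ! n else Void)"

definition tape_of :: "'s work_symbol list \<Rightarrow> 's work_symbol list \<Rightarrow> int \<Rightarrow> 's work_symbol" where
  "tape_of L R i = (if i \<ge> 0 then nth_void R (nat i) else nth_void L (nat (-1 - i)))"

text \<open>The reversals cancel the bottom-first layout, so that \<open>L\<close> and
  \<open>R\<close> list the cells from the origin outwards, as in \<open>tape_of\<close>.\<close>

definition io :: "'k \<Rightarrow> 'e list \<Rightarrow> 'e list \<Rightarrow> ('k, 'e) store" where
  "io main L R = (\<lambda>_. [])((main, True) := rev R, (main, False) := rev L)"

text \<open>The control state is the list of programs still to be run, with a phase for the stack
  operation at its head. Only finitely many such lists occur in the runs of \<open>c\<close>.\<close>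

definition controls :: "'e set \<Rightarrow> ('k, 'e) com \<Rightarrow> ('k, 'e) control set" where
  "controls E c = {Init, Fin} \<union>
     (\<lambda>(cs, p). At cs p) ` (insert [] (conts E c []) \<times>
        ({Start, Seek, Take} \<union> Ret ` insert None (Some ` E)))"

lemma finite_controls: "finite E \<Longrightarrow> finite (controls E c)"
  unfolding controls_def by (auto intro!: finite_conts)

definition cells_over :: "'e set \<Rightarrow> ('k, 'e) cell set" where
  "cells_over E = UNIV \<times> {g. range g \<subseteq> insert None (Some ` E)}"

lemma finite_cells_over:
  assumes "finite E"
  shows "finite (cells_over E :: ('k::finite, 'e) cell set)"
proof -
  have "{g. range g \<subseteq> insert None (Some ` E)} = (UNIV :: 'k set) \<rightarrow>\<^sub>E insert None (Some ` E)"
    by auto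
  then show ?thesis unfolding cells_over_def using assms
    by (auto intro!: finite_cartesian_product finite_PiE)
qed

text \<open>The last two assumptions make a plain input tape the layout of the store in which only
  the two main stacks are non-empty, up to the mark on cell 0.\<close>

locale compiled =
  fixes E :: "'s::finite work_symbol set"
    and main :: "'k::finite"
    and c0 :: "('k, 's work_symbol) com"
    and code :: "('k, 's work_symbol) control \<Rightarrow> nat"
    and enc :: "('k, 's work_symbol) cell \<Rightarrow> 's work_symbol"
  assumes finE: "finite E" and SymE: "range Sym \<subseteq> E" and pushes: "pushes_in E c0"
    and code: "inj_on code (controls E c0)" "code Init = 0"
    and enc: "inj_on enc (cells_over E)"
    and enc_Void: "enc (False, Map.empty) = Void"
    and enc_Sym: "\<And>a. enc (False, [main \<mapsto> Sym a]) = Sym a"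
begin

text \<open>Leaving the table undefined outside the two finite images makes its domain finite; on
  them, injectivity of \<open>code\<close> and \<open>enc\<close> lets \<open>inv_into\<close>
  recover control state and cell.\<close>

definition table :: "'s machine" where
  "table = (\<lambda>(q, a). if q \<in> code ` controls E c0 \<and> a \<in> enc ` cells_over E then
     map_option (\<lambda>(st, x, d). (code st, enc x, d))
       (delta c0 (inv_into (controls E c0) code q) (inv_into (cells_over E) enc a)) else None)"

definition conf where
  "conf st h w = (code st, h, \<lambda>i::int. enc (w i))"

abbreviation run where
  "run \<equiv> (\<lambda>d d'. step table d = Some d')\<^sup>*\<^sup>*"

lemma turing_machine_table: "turing_machine table"
  unfolding turing_machine_def
proof (rule finite_subset)
  show "dom table \<subseteq> code ` controls E c0 \<times> enc ` cells_over E"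
    by (auto simp: table_def split: if_splits)
  show "finite (code ` controls E c0 \<times> enc ` cells_over E)"
    by (intro finite_cartesian_product finite_imageI finite_controls finite_cells_over finE)
qed

lemma step_conf:
  assumes "st \<in> controls E c0" "w h \<in> cells_over E"
  shows "step table (conf st h w) = map_option (\<lambda>(st', x, d). conf st' (h + offset d) (w(h := x)))
    (delta c0 st (w h))"
proof -
  have "table (code st, enc (w h)) = map_option (\<lambda>(st, x, d). (code st, enc x, d)) (delta c0 st (w h))"
    using assms code(1) enc by (simp add: table_def)
  then show ?thesis by (cases "delta c0 st (w h)") (auto simp: conf_def)
qed

lemma run_step:
  assumes "delta c0 st (w h) = Some (st', x, d)" "st \<in> controls E c0" "w h \<in> cells_over E"
    "h' = h + offset d" "w' = w(h := x)"
  shows "run (conf st h w) (conf st' h' w')"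
  using assms by (intro r_into_rtranclp) (simp add: step_conf)

lemma layout_in_cells: "store_in E s \<Longrightarrow> layout s i \<in> cells_over E"
proof -
  assume s: "store_in E s"
  have "nth_opt (rev (s k)) n \<in> insert None (Some ` E)" for k n
    using store_inD[OF s, of k] nth_mem[of n "rev (s k)"] unfolding nth_opt_def by auto
  then show ?thesis unfolding cells_over_def layout_def by auto
qed

lemma At_in_controls:
  assumes "cs \<in> insert [] (conts E c0 [])"
    and "p \<in> {Start, Seek, Take} \<union> Ret ` insert None (Some ` E)"
  shows "At cs p \<in> controls E c0"
  using assms unfolding controls_def by blast

section \<open>The round trip of the head for a single stack operation\<close>

lemma run_seek:
  assumes "access c = Some ((j, d), w)" "c # cs \<in> conts E c0 []" "store_in E s"
    and "n \<le> length (s (j, d))"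
  shows "run (conf (At (c # cs) Seek) (pos d n) (layout s))
             (conf (At (c # cs) Seek) (pos d (length (s (j, d)))) (layout s))"
  using assms(4)
proof (induction "length (s (j, d)) - n" arbitrary: n)
  case 0
  then show ?case by simp
next
  case (Suc m)
  have "run (conf (At (c # cs) Seek) (pos d n) (layout s))
            (conf (At (c # cs) Seek) (pos d (Suc n)) (layout s))"
  proof (rule run_step)
    show "delta c0 (At (c # cs) Seek) (layout s (pos d n))
       = Some (At (c # cs) Seek, layout s (pos d n), outwards d)"
      using Suc assms(1) by (auto simp: layout_pos nth_opt_def)
  qed (use assms layout_in_cells At_in_controls in \<open>auto simp: pos_Suc\<close>)
  moreover have "run (conf (At (c # cs) Seek) (pos d (Suc n)) (layout s))
             (conf (At (c # cs) Seek) (pos d (length (s (j, d)))) (layout s))"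
    using Suc by (intro Suc.hyps(1)) auto
  ultimately show ?case by (rule rtranclp_trans)
qed

lemma run_ret_home:
  assumes "access c = Some ((j, d), w)" "c # cs \<in> conts E c0 []" "store_in E s"
    and "v \<in> insert None (Some ` E)"
  shows "run (conf (At (c # cs) (Ret v)) 0 (layout s))
             (conf (At (continue c cs v) Start) 0 (layout s))"
proof (rule run_step)
  show "delta c0 (At (c # cs) (Ret v)) (layout s 0)
       = Some (At (continue c cs v) Start, layout s 0, Stay)"
    using assms(1) by (auto simp: layout_def)
qed (use assms layout_in_cells At_in_controls in auto)

lemma run_ret:
  assumes "access c = Some ((j, d), w)" "c # cs \<in> conts E c0 []" "store_in E s"
    and v: "v \<in> insert None (Some ` E)"
  shows "run (conf (At (c # cs) (Ret v)) (pos d n) (layout s))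
             (conf (At (continue c cs v) Start) 0 (layout s))"
proof (induction n)
  case 0
  show ?case
  proof (cases d)
    case True
    then show ?thesis using run_ret_home[OF assms] by (simp add: pos_True_0)
  next
    case False
    \<comment> \<open>The innermost cell of the negative side is -1, so one more step is needed to
      reach the mark.\<close>
    have "run (conf (At (c # cs) (Ret v)) (pos d 0) (layout s))
              (conf (At (c # cs) (Ret v)) 0 (layout s))"
    proof (rule run_step)
      show "delta c0 (At (c # cs) (Ret v)) (layout s (pos d 0))
         = Some (At (c # cs) (Ret v), layout s (pos d 0), outwards (\<not> d))"
        using assms(1) False by (auto simp: layout_pos)
    qed (use assms layout_in_cells At_in_controls False pos_back_0 in auto)
    with run_ret_home[OF assms] show ?thesis by (meson rtranclp_trans)
  qed
next
  case (Suc n)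
  have "run (conf (At (c # cs) (Ret v)) (pos d (Suc n)) (layout s))
            (conf (At (c # cs) (Ret v)) (pos d n) (layout s))"
  proof (rule run_step)
    show "delta c0 (At (c # cs) (Ret v)) (layout s (pos d (Suc n)))
       = Some (At (c # cs) (Ret v), layout s (pos d (Suc n)), outwards (\<not> d))"
      using assms(1) by (auto simp: layout_pos)
  qed (use assms layout_in_cells At_in_controls in \<open>auto simp: pos_back\<close>)
  with Suc show ?case by (meson rtranclp_trans)
qed

text \<open>Push, pop and the test of a loop are the same trip and are treated together:
  \<open>w\<close> is the symbol to be written, and \<open>w = None\<close> means that the top is
  removed. Since every trip starts and ends at cell 0, programs can be composed without tracking the
  head.\<close>

lemma run_access:
  assumes acc: "access c = Some (k, w)" and c: "c # cs \<in> conts E c0 []" and s: "store_in E s"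
    and w: "\<And>e. w = Some e \<Longrightarrow> e \<in> E"
    and s': "s' = s(k := case w of None \<Rightarrow> tl (s k) | Some e \<Rightarrow> e # s k)"
    and v: "v = (case w of None \<Rightarrow> peek (s k) | Some e \<Rightarrow> None)"
  shows "run (conf (At (c # cs) Start) 0 (layout s))
             (conf (At (continue c cs v) Start) 0 (layout s'))"
proof -
  obtain j d where k: "k = (j, d)" by (cases k)
  have vE: "v \<in> insert None (Some ` E)"
    using store_in_peek[OF s, of k] unfolding v by (auto split: option.splits)
  have s'E: "store_in E s'"
  proof (cases w)
    case None
    then show ?thesis using store_in_tl[OF s] unfolding s' by simp
  next
    case (Some e)
    then have "set (e # s k) \<subseteq> E" using s w store_inD[OF s, of k] by auto
    then show ?thesis using s Some unfolding s' by (auto intro!: store_in_upd)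
  qed
  have acc': "access c = Some ((j, d), w)" using acc k by simp
  have "run (conf (At (c # cs) Start) 0 (layout s))
            (conf (At (c # cs) Seek) (pos d 0) (layout s))"
  proof (rule run_step)
    show "delta c0 (At (c # cs) Start) (layout s 0)
       = Some (At (c # cs) Seek, layout s 0, if d then Stay else MoveLeft)"
      using acc' by (auto simp: layout_def)
  qed (use c s layout_in_cells At_in_controls in \<open>auto simp: pos_def\<close>)
  also have "run \<dots> (conf (At (c # cs) Seek) (pos d (length (s (j, d)))) (layout s))"
    by (rule run_seek[OF acc' c s]) simp
  also have "run \<dots> (conf (At (continue c cs v) Start) 0 (layout s'))"
  proof (cases w)
    case (Some e)
    then have s'_eq: "s' = s((j, d) := e # s (j, d))" and v_eq: "v = None"
      using s' v k by auto
    have "run (conf (At (c # cs) Seek) (pos d (length (s (j, d)))) (layout s))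
       (conf (At (c # cs) (Ret v)) (pos d (length (s (j, d)))) (layout s'))"
    proof (rule run_step)
      show "delta c0 (At (c # cs) Seek) (layout s (pos d (length (s (j, d)))))
         = Some (At (c # cs) (Ret v),
             (d \<and> s (j, d) = [], (\<lambda>j'. nth_opt (rev (s (j', d))) (length (s (j, d))))(j := Some e)), Stay)"
        using acc' Some v_eq by (auto simp: layout_pos nth_opt_def)
      show "layout s' = (layout s)(pos d (length (s (j, d))) :=
        (d \<and> s (j, d) = [], (\<lambda>j'. nth_opt (rev (s (j', d))) (length (s (j, d))))(j := Some e)))"
        unfolding s'_eq layout_push ..
    qed (use c s layout_in_cells At_in_controls in auto)
    also have "run \<dots> (conf (At (continue c cs v) Start) 0 (layout s'))"
      by (rule run_ret[OF acc' c s'E vE])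
    finally show ?thesis .
  next
    case None
    show ?thesis
    proof (cases "s (j, d)")
      case Nil
      then have s'_eq: "s' = s" and v_eq: "v = None"
        using s' v k None by (auto simp: fun_eq_iff)
      show ?thesis
      proof (cases d)
        case True
        \<comment> \<open>\<open>Seek\<close> has stopped on the marked cell itself, which on this
          side already proves the stack empty.\<close>
        have "run (conf (At (c # cs) Seek) (pos d (length (s (j, d)))) (layout s))
          (conf (At (c # cs) (Ret v)) 0 (layout s))"
        proof (rule run_step)
          show "delta c0 (At (c # cs) Seek) (layout s (pos d (length (s (j, d)))))
            = Some (At (c # cs) (Ret v), layout s (pos d (length (s (j, d)))), Stay)"
            using acc' None Nil True v_eq by (auto simp: layout_pos nth_opt_def)
        qed (use c s layout_in_cells At_in_controls Nil True in \<open>auto simp: pos_True_0\<close>)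
        also have "run \<dots> (conf (At (continue c cs v) Start) 0 (layout s'))"
          unfolding s'_eq by (rule run_ret_home[OF acc' c s vE])
        finally show ?thesis .
      next
        case False
        \<comment> \<open>Here \<open>Seek\<close> stops at cell -1; emptiness is noticed only when
          \<open>Take\<close> meets the mark on cell 0.\<close>
        have "run (conf (At (c # cs) Seek) (pos d (length (s (j, d)))) (layout s))
          (conf (At (c # cs) Take) 0 (layout s))"
        proof (rule run_step)
          show "delta c0 (At (c # cs) Seek) (layout s (pos d (length (s (j, d)))))
            = Some (At (c # cs) Take, layout s (pos d (length (s (j, d)))), outwards (\<not> d))"
            using acc' None Nil False by (auto simp: layout_pos nth_opt_def)
        qed (use c s layout_in_cells At_in_controls Nil False pos_back_0 in auto)
        also have "run \<dots> (conf (At (c # cs) (Ret v)) 0 (layout s))"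
        proof (rule run_step)
          show "delta c0 (At (c # cs) Take) (layout s 0)
            = Some (At (c # cs) (Ret v), layout s 0, Stay)"
            using acc' False v_eq by (auto simp: layout_def)
        qed (use c s layout_in_cells At_in_controls in auto)
        also have "run \<dots> (conf (At (continue c cs v) Start) 0 (layout s'))"
          unfolding s'_eq by (rule run_ret_home[OF acc' c s vE])
        finally show ?thesis .
      qed
    next
      case (Cons e l)
      then have s'_eq: "s' = s((j, d) := l)" and v_eq: "v = Some e"
        using s' v k None by auto
      have "run (conf (At (c # cs) Seek) (pos d (length (s (j, d)))) (layout s))
          (conf (At (c # cs) Take) (pos d (length l)) (layout s))"
      proof (rule run_step)
        show "delta c0 (At (c # cs) Seek) (layout s (pos d (length (s (j, d)))))
            = Some (At (c # cs) Take, layout s (pos d (length (s (j, d)))), outwards (\<not> d))"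
          using acc' None Cons by (auto simp: layout_pos nth_opt_def)
      qed (use c s layout_in_cells At_in_controls Cons in \<open>auto simp: pos_back\<close>)
      also have "run \<dots> (conf (At (c # cs) (Ret v)) (pos d (length l)) (layout s'))"
      proof (rule run_step)
        show "delta c0 (At (c # cs) Take) (layout s (pos d (length l)))
          = Some (At (c # cs) (Ret v),
              (d \<and> l = [], (\<lambda>j'. nth_opt (rev (s (j', d))) (length l))(j := None)), Stay)"
          using acc' Cons v_eq by (auto simp: layout_pos nth_opt_def nth_append)
        show "layout s' = (layout s)(pos d (length l) :=
            (d \<and> l = [], (\<lambda>j'. nth_opt (rev (s (j', d))) (length l))(j := None)))"
          unfolding s'_eq layout_pop[where s = s and j = j and d = d, OF Cons] ..
      qed (use c s layout_in_cells At_in_controls in auto)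
      also have "run \<dots> (conf (At (continue c cs v) Start) 0 (layout s'))"
        by (rule run_ret[OF acc' c s'E vE])
      finally show ?thesis .
    qed
  qed
  finally show ?thesis .
qed

text \<open>Rule induction on the derivation. The rest \<open>cs\<close> stays arbitrary because
  subprograms run in front of longer lists; the two conditions on \<open>conts\<close> guarantee
  that every control state met lies where \<open>table\<close> is defined.\<close>

lemma run_exec:
  assumes "exec c s s'" "pushes_in E c" "store_in E s"
    and "conts E c cs \<subseteq> conts E c0 []" "cs \<in> insert [] (conts E c0 [])"
  shows "run (conf (At (c # cs) Start) 0 (layout s)) (conf (At cs Start) 0 (layout s'))
    \<and> store_in E s'"
  using assms
proof (induction arbitrary: cs rule: exec.induct)
  case (Skip s)
  have "run (conf (At (com.Skip # cs) Start) 0 (layout s)) (conf (At cs Start) 0 (layout s))"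
  proof (rule run_step)
    show "delta c0 (At (com.Skip # cs) Start) (layout s 0) = Some (At cs Start, layout s 0, Stay)"
      by (auto simp: layout_def)
  qed (use Skip layout_in_cells At_in_controls in auto)
  with Skip show ?case by simp
next
  case (Push k e s)
  have "run (conf (At (com.Push k e # cs) Start) 0 (layout s))
      (conf (At (continue (com.Push k e) cs None) Start) 0 (layout (s(k := e # s k))))"
    by (rule run_access) (use Push in auto)
  moreover have "set (e # s k) \<subseteq> E"
    using Push.prems store_inD[of E s k] by auto
  ultimately show ?case using Push.prems(2) store_in_upd[of E s "e # s k" k]
    by (simp add: fun_upd_def)
next
  case (Pop f s k s')
  have peek: "peek (s k) \<in> insert None (Some ` E)" by (rule store_in_peek[OF Pop.prems(2)])
  have "run (conf (At (com.Pop k f # cs) Start) 0 (layout s))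
      (conf (At (continue (com.Pop k f) cs (peek (s k))) Start) 0 (layout (s(k := tl (s k)))))"
    by (rule run_access) (use Pop.prems in auto)
  moreover have "run (conf (At (f (peek (s k)) # cs) Start) 0 (layout (s(k := tl (s k)))))
      (conf (At cs Start) 0 (layout s')) \<and> store_in E s'"
  proof (rule Pop.IH)
    show "store_in E (s(k := tl (s k)))" by (rule store_in_tl[OF Pop.prems(2)])
    show "pushes_in E (f (peek (s k)))" using Pop.prems(1) peek by auto
    have "conts E (f (peek (s k))) cs \<subseteq> conts E (com.Pop k f) cs" using peek by auto
    then show "conts E (f (peek (s k))) cs \<subseteq> conts E c0 []" using Pop.prems(3) by blast
  qed (use Pop.prems in auto)
  ultimately show ?case by (auto intro: rtranclp_trans)
next
  case (Drain_Nil s k f)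
  have "run (conf (At (com.Drain k f # cs) Start) 0 (layout s))
      (conf (At (continue (com.Drain k f) cs None) Start) 0 (layout s))"
    by (rule run_access) (use Drain_Nil in \<open>auto simp: fun_eq_iff\<close>)
  with Drain_Nil show ?case by simp
next
  case (Drain_Cons s k e l f s' s'')
  have "set (e # l) \<subseteq> E"
    using store_inD[OF Drain_Cons.prems(2), of k] Drain_Cons.hyps(1) by simp
  then have e: "e \<in> E" and l: "store_in E (s(k := l))"
    using store_in_upd[OF Drain_Cons.prems(2)] by auto
  have "run (conf (At (com.Drain k f # cs) Start) 0 (layout s))
      (conf (At (continue (com.Drain k f) cs (Some e)) Start) 0 (layout (s(k := l))))"
    by (rule run_access) (use Drain_Cons in auto)
  moreover have *: "run (conf (At (f e # com.Drain k f # cs) Start) 0 (layout (s(k := l))))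
      (conf (At (com.Drain k f # cs) Start) 0 (layout s')) \<and> store_in E s'"
  proof (rule Drain_Cons.IH(1))
    show "store_in E (s(k := l))" by (rule l)
  qed (use Drain_Cons.prems e in auto)
  moreover have "run (conf (At (com.Drain k f # cs) Start) 0 (layout s'))
      (conf (At cs Start) 0 (layout s'')) \<and> store_in E s''"
    by (rule Drain_Cons.IH(2)) (use Drain_Cons.prems * in auto)
  ultimately show ?case by (auto intro: rtranclp_trans)
next
  case (Seq c s s' d s'')
  have "run (conf (At (com.Seq c d # cs) Start) 0 (layout s))
      (conf (At (c # d # cs) Start) 0 (layout s))"
  proof (rule run_step)
    show "delta c0 (At (com.Seq c d # cs) Start) (layout s 0)
      = Some (At (c # d # cs) Start, layout s 0, Stay)"
      by (auto simp: layout_def)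
  qed (use Seq.prems layout_in_cells At_in_controls in auto)
  moreover have *: "run (conf (At (c # d # cs) Start) 0 (layout s))
      (conf (At (d # cs) Start) 0 (layout s')) \<and> store_in E s'"
    by (rule Seq.IH(1)) (use Seq.prems conts_self[of d cs E] in auto)
  moreover have "run (conf (At (d # cs) Start) 0 (layout s'))
      (conf (At cs Start) 0 (layout s'')) \<and> store_in E s''"
    by (rule Seq.IH(2)) (use Seq.prems * in auto)
  ultimately show ?case by (auto intro: rtranclp_trans)
qed

lemma enc_layout_io:
  assumes "set L \<subseteq> range Sym" "set R \<subseteq> range Sym"
  shows "enc (False, snd (layout (io main L R) i)) = tape_of L R i"
proof -
  obtain d n where i: "i = pos d n" by (rule pos_cases)
  define l where "l = (if d then R else L)"
  have "snd (layout (io main L R) i) = (\<lambda>j. if j = main then nth_opt l n else None)"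
    unfolding i by (auto simp: layout_pos io_def l_def nth_opt_def fun_eq_iff)
  moreover have "tape_of L R i = nth_void l n"
    unfolding i by (auto simp: tape_of_def pos_def l_def)
  moreover have "enc (False, \<lambda>j. if j = main then nth_opt l n else None) = nth_void l n"
  proof (cases "n < length l")
    case True
    then have "l ! n \<in> range Sym" using assms nth_mem[OF True] by (auto simp: l_def split: if_splits)
    moreover have "(\<lambda>j. if j = main then nth_opt l n else None) = [main \<mapsto> l ! n]"
      using True by (auto simp: nth_opt_def fun_eq_iff)
    ultimately show ?thesis using True enc_Sym by (auto simp: nth_void_def)
  next
    case False
    then have "(\<lambda>j. if j = main then nth_opt l n else None) = Map.empty"
      by (auto simp: nth_opt_def fun_eq_iff)
    then show ?thesis using False enc_Void by (simp add: nth_void_def)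
  qed
  ultimately show ?thesis by simp
qed

lemma outputs_table:
  assumes "load t = tape_of L R" "set L \<subseteq> range Sym" "set R \<subseteq> range Sym"
    and "load t' = tape_of L' R'" "set L' \<subseteq> range Sym" "set R' \<subseteq> range Sym"
    and ex: "exec c0 (io main L R) (io main L' R')"
  shows "outputs table t t'"
proof -
  let ?s = "io main L R" and ?s' = "io main L' R'"
  \<comment> \<open>Input and output tapes carry no mark: the first step of the machine sets it on
    cell 0 and the last one removes it. \<open>bare\<close> is the tape before and after.\<close>
  define bare where "bare s i = (False, snd (layout s i))" for s :: "('k, 's work_symbol) store" and i
  have upd: "(bare s)(0 := (True, snd (layout s 0))) = layout s"
    "(layout s)(0 := (False, snd (layout s 0))) = bare s" for s
    by (auto simp: bare_def layout_def fun_eq_iff)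
  have s: "store_in E ?s"
    using assms(2,3) SymE by (auto simp: store_in_def io_def)
  have bare_cells: "bare s i \<in> cells_over E" if "store_in E s" for s i
    using layout_in_cells[OF that, of i] by (auto simp: bare_def cells_over_def)
  have "run (conf Init 0 (bare ?s)) (conf (At [c0] Start) 0 (layout ?s))"
  proof (rule run_step)
    show "delta c0 Init (bare ?s 0) = Some (At [c0] Start, (True, snd (layout ?s 0)), Stay)"
      by (simp add: bare_def)
    show "layout ?s = (bare ?s)(0 := (True, snd (layout ?s 0)))"
      by (simp add: upd)
  qed (use bare_cells[OF s] in \<open>auto simp: controls_def\<close>)
  also have *: "run (conf (At [c0] Start) 0 (layout ?s)) (conf (At [] Start) 0 (layout ?s'))
      \<and> store_in E ?s'"
    by (rule run_exec[OF ex pushes s]) auto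
  then have "run (conf (At [c0] Start) 0 (layout ?s)) (conf (At [] Start) 0 (layout ?s'))" ..
  also have "run (conf (At [] Start) 0 (layout ?s')) (conf Fin 0 (bare ?s'))"
  proof (rule run_step)
    show "delta c0 (At [] Start) (layout ?s' 0) = Some (Fin, (False, snd (layout ?s' 0)), Stay)"
      by (cases "layout ?s' 0") simp
    show "bare ?s' = (layout ?s')(0 := (False, snd (layout ?s' 0)))"
      by (simp add: upd)
  qed (use layout_in_cells * in \<open>auto simp: controls_def\<close>)
  finally have "run (conf Init 0 (bare ?s)) (conf Fin 0 (bare ?s'))" .
  moreover have "step table (conf Fin 0 (bare ?s')) = None"
    by (subst step_conf) (use bare_cells * in \<open>auto simp: controls_def\<close>)
  moreover have "conf Init 0 (bare ?s) = (0, 0, load t)" "conf Fin 0 (bare ?s') = (code Fin, 0, load t')"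
    using assms code(2) by (auto simp: conf_def bare_def enc_layout_io fun_eq_iff)
  ultimately show ?thesis unfolding outputs_def halts_in_def by metis
qed

end

lemma stack_program_machine:
  fixes c :: "('k::finite, 's::finite work_symbol) com"
  assumes "finite E" "range Sym \<subseteq> E" "pushes_in E c"
  obtains T :: "'s machine" where "turing_machine T"
    and "\<And>t t' L R L' R'. \<lbrakk>load t = tape_of L R; set L \<subseteq> range Sym; set R \<subseteq> range Sym;
      load t' = tape_of L' R'; set L' \<subseteq> range Sym; set R' \<subseteq> range Sym;
      exec c (io main L R) (io main L' R')\<rbrakk> \<Longrightarrow> outputs T t t'"
proof -
  let ?Q = "controls E c" and ?B = "cells_over E :: ('k, 's work_symbol) cell set"
  have "finite ?Q" using assms(1) by (rule finite_controls)
  then obtain code0 :: "('k, 's work_symbol) control \<Rightarrow> nat" where code0: "inj_on code0 ?Q"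
    by (metis finite_imp_inj_to_nat_seg)
  \<comment> \<open>The shift by \<open>Suc\<close> reserves 0, the start state of every machine,
    for \<open>Init\<close>.\<close>
  define code where "code st = (if st = Init then 0 else Suc (code0 st))" for st
  have code: "inj_on code ?Q" "code Init = 0"
    using code0 by (auto simp: code_def inj_on_def)
  have "finite ?B" using assms(1) by (rule finite_cells_over)
  then obtain enc0 :: "('k, 's work_symbol) cell \<Rightarrow> nat" where enc0: "inj_on enc0 ?B"
    by (metis finite_imp_inj_to_nat_seg)
  \<comment> \<open>Cells of a plain tape must keep their own symbol, and all others get an
    \<open>Aux\<close> symbol. The three constructors cannot clash, so injectivity is inherited from
    \<open>enc0\<close>. A \<open>Void\<close> stored as data on the main track is an ordinary stack
    symbol and receives an \<open>Aux\<close> code, distinct from the empty cell.\<close>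
  define enc where "enc x = (if x = (False, Map.empty) then Void
    else if \<exists>a. x = (False, [main \<mapsto> Sym a]) then Sym (THE a. x = (False, [main \<mapsto> Sym a]))
    else Aux (enc0 x))" for x :: "('k, 's work_symbol) cell"
  have upd_inj: "[main \<mapsto> Sym a] = [main \<mapsto> Sym b] \<longleftrightarrow> a = b" for a b :: "'s option"
    by (metis fun_upd_same option.inject work_symbol.inject(1))
  have enc_Sym: "enc (False, [main \<mapsto> Sym a]) = Sym a" for a
    by (auto simp: enc_def upd_inj)
  have enc_Void: "enc (False, Map.empty) = Void" by (simp add: enc_def)
  have enc: "inj_on enc ?B"
  proof (rule inj_onI)
    fix x y assume xy: "x \<in> ?B" "y \<in> ?B" "enc x = enc y"
    have *: "(x = (False, Map.empty) \<and> enc x = Void)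
        \<or> (\<exists>a. x = (False, [main \<mapsto> Sym a]) \<and> enc x = Sym a) \<or> enc x = Aux (enc0 x)" for x
      using enc_Void enc_Sym unfolding enc_def by metis
    show "x = y"
    proof (cases "enc x")
      case Void
      then show ?thesis using *[of x] *[of y] xy by simp
    next
      case (Sym a)
      then show ?thesis using *[of x] *[of y] xy by auto
    next
      case (Aux n)
      then have "enc0 x = enc0 y" using *[of x] *[of y] xy by auto
      then show ?thesis using enc0 xy by (auto dest: inj_onD)
    qed
  qed
  interpret compiled E main c code enc
    by unfold_locales (use assms code enc enc_Void enc_Sym in auto)
  show ?thesis
    by (rule that[OF turing_machine_table]) (rule outputs_table)
qed

section \<open>Total correctness of stack programs\<close>

text \<open>The existential form includes termination. The postcondition may itself be a
  \<open>wp\<close>, which is how the rest of a program is carried through the rules below.\<close>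

definition wp :: "('k, 'e) com \<Rightarrow> ('k, 'e) store \<Rightarrow> (('k, 'e) store \<Rightarrow> bool) \<Rightarrow> bool" where
  "wp c s P \<longleftrightarrow> (\<exists>s'. exec c s s' \<and> P s')"

lemma wp_Skip: "P s \<Longrightarrow> wp Skip s P"
  unfolding wp_def by (blast intro: exec.Skip)

lemma wp_Push: "P (s(k := e # s k)) \<Longrightarrow> wp (Push k e) s P"
  unfolding wp_def by (blast intro: exec.Push)

lemma wp_Pop: "wp (f (peek (s k))) (s(k := tl (s k))) P \<Longrightarrow> wp (Pop k f) s P"
  unfolding wp_def by (blast intro: exec.Pop)

lemma wp_Seq: "wp c s (\<lambda>s'. wp d s' P) \<Longrightarrow> wp (Seq c d) s P"
  unfolding wp_def by (blast intro: exec.Seq)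

lemma wp_Drain_Nil: "s k = [] \<Longrightarrow> P s \<Longrightarrow> wp (Drain k f) s P"
  unfolding wp_def by (blast intro: exec.Drain_Nil)

lemma wp_Drain_Cons:
  "s k = e # l \<Longrightarrow> wp (f e) (s(k := l)) (\<lambda>s'. wp (Drain k f) s' P) \<Longrightarrow> wp (Drain k f) s P"
  unfolding wp_def by (blast intro: exec.Drain_Cons)

definition move_stack :: "'k \<times> bool \<Rightarrow> 'k \<times> bool \<Rightarrow> ('k, 'e) com" where
  "move_stack a b = Drain a (Push b)"

definition clear :: "'k \<times> bool \<Rightarrow> ('k, 'e) com" where
  "clear a = Drain a (\<lambda>_. Skip)"

lemma wp_clear: "P (s(a := [])) \<Longrightarrow> wp (clear a) s P"
proof (induction "s a" arbitrary: s)
  case Nil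
  then have "s(a := []) = s" by (simp add: fun_eq_iff)
  with Nil show ?case unfolding clear_def by (intro wp_Drain_Nil) auto
next
  case (Cons e l)
  have *: "wp (clear a) (s(a := l)) P" by (rule Cons.hyps(1)) (use Cons.prems in auto)
  show ?case unfolding clear_def
    by (rule wp_Drain_Cons, rule Cons.hyps(2)[symmetric], rule wp_Skip, rule *[unfolded clear_def])
qed

lemma wp_move_stack:
  assumes "a \<noteq> b" "P (s(a := [], b := rev (s a) @ s b))"
  shows "wp (move_stack a b) s P"
  using assms(2)
proof (induction "s a" arbitrary: s)
  case Nil
  then have *: "s(a := [], b := rev (s a) @ s b) = s" by (auto simp: fun_eq_iff)
  have "P s" using Nil.prems unfolding * .
  with Nil.hyps show ?case unfolding move_stack_def by (intro wp_Drain_Nil) auto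
next
  case (Cons e l)
  let ?s = "s(a := l, b := e # s b)"
  have "?s(a := [], b := rev (?s a) @ ?s b) = s(a := [], b := rev (s a) @ s b)"
    using Cons.hyps(2)[symmetric] assms(1) by (auto simp: fun_eq_iff)
  then have "wp (move_stack a b) ?s P"
    using Cons.prems assms(1) by (intro Cons.hyps(1)) auto
  then have *: "wp (Push b e) (s(a := l)) (\<lambda>s'. wp (move_stack a b) s' P)"
    using assms(1) by (intro wp_Push) simp
  show ?case unfolding move_stack_def
    by (rule wp_Drain_Cons, rule Cons.hyps(2)[symmetric], rule *[unfolded move_stack_def])
qed

section \<open>Tapes as pairs of lists\<close>

fun sym_of :: "'s work_symbol \<Rightarrow> 's option" where
  "sym_of (Sym a) = a"
| "sym_of _ = None"

lemma nth_void_simps [simp]: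
  "nth_void [] n = Void" "nth_void (e # l) 0 = e" "nth_void (e # l) (Suc n) = nth_void l n"
  by (auto simp: nth_void_def)

lemma sym_of_load: "sym_of (load t i) = cells t i"
proof (cases "cells t i")
  case None
  then show ?thesis by (simp add: load_def)
next
  case (Some a)
  then have "i \<in> insert 0 (dom (cells t))" by auto
  then have "load t i = Sym (cells t i)" unfolding load_def Let_def by (metis order_refl)
  then show ?thesis by simp
qed

text \<open>\<open>sym_of\<close> recovers the cells, since both \<open>Void\<close> and the blank
  symbol are read as \<open>None\<close>. Equality of tapes can therefore be tested on work
  tapes.\<close>

lemma load_inject: "load t = load t' \<longleftrightarrow> t = t'"
proof
  assume "load t = load t'"
  then have "cells t i = cells t' i" for i by (metis sym_of_load)
  then show "t = t'" by (simp add: cells_inject[symmetric] fun_eq_iff)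
qed simp

text \<open>Normal form of one half of a tape, listed outwards: without an outermost blank the list
  ends where the least interval used by \<open>load\<close> ends.\<close>

definition trimmed :: "'s work_symbol list \<Rightarrow> bool" where
  "trimmed l \<longleftrightarrow> set l \<subseteq> range Sym \<and> (l \<noteq> [] \<longrightarrow> last l \<noteq> Sym None)"

definition trim_Cons :: "'s work_symbol \<Rightarrow> 's work_symbol list \<Rightarrow> 's work_symbol list" where
  "trim_Cons e l = (if e = Sym None \<and> l = [] then [] else e # l)"

lemma trimmed_Nil: "trimmed []"
  by (simp add: trimmed_def)

lemma trimmed_trim_Cons: "trimmed l \<Longrightarrow> e \<in> range Sym \<Longrightarrow> trimmed (trim_Cons e l)"
  by (auto simp: trimmed_def trim_Cons_def)

lemma trimmed_tl: "trimmed l \<Longrightarrow> trimmed (tl l)"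
  by (cases l) (auto simp: trimmed_def)

definition tape_of_halves :: "'s work_symbol list \<Rightarrow> 's work_symbol list \<Rightarrow> 's tape" where
  "tape_of_halves L R = Tape (\<lambda>i. sym_of (tape_of L R i))"

lemma cells_tape_of_halves: "cells (tape_of_halves L R) i = sym_of (tape_of L R i)"
proof -
  have "dom (\<lambda>i. sym_of (tape_of L R i)) \<subseteq> {- int (length L)..<int (length R)}"
    by (auto simp: tape_of_def nth_void_def split: if_splits)
  then have "finite (dom (\<lambda>i. sym_of (tape_of L R i)))"
    by (rule finite_subset) simp
  then show ?thesis unfolding tape_of_halves_def by (subst Tape_inverse) auto
qed

lemma last_nonblank:
  assumes "trimmed l" "n < length l"
  shows "n \<le> length l - 1" "sym_of (nth_void l (length l - 1)) \<noteq> None"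
proof -
  have "l \<noteq> []" using assms(2) by auto
  then have "last l \<in> set l" by (rule last_in_set)
  then obtain a where "last l = Sym a" using assms(1) unfolding trimmed_def by blast
  moreover from this have "a \<noteq> None" using assms(1) \<open>l \<noteq> []\<close> unfolding trimmed_def by auto
  ultimately show "sym_of (nth_void l (length l - 1)) \<noteq> None"
    using assms(2) \<open>l \<noteq> []\<close> by (simp add: nth_void_def last_conv_nth)
qed (use assms in simp)

text \<open>The ends of a non-empty trimmed half are non-blank cells and hence ends of the loaded
  interval. That interval always contains cell 0, which belongs to the right half; so an empty right
  half is loaded as a single blank.\<close>

lemma load_tape_of_halves:
  assumes L: "trimmed L" and R: "trimmed R"
  shows "load (tape_of_halves L R) = tape_of L (if R = [] then [Sym None] else R)"
proof
  fix i :: int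
  let ?t = "tape_of_halves L R"
  let ?S = "insert 0 (dom (cells ?t))"
  have mem: "j \<in> ?S \<longleftrightarrow> j = 0 \<or> sym_of (tape_of L R j) \<noteq> None" for j
    by (auto simp: dom_def cells_tape_of_halves)
  \<comment> \<open>The value 1 in the maximum accounts for cell 0 when \<open>R\<close> is
    empty.\<close>
  have bounds: "- int (length L) \<le> j \<and> j < int (max 1 (length R))" if "j \<in> ?S" for j
    using that unfolding mem by (auto simp: tape_of_def nth_void_def split: if_splits)
  have "(\<exists>a\<in>?S. \<exists>b\<in>?S. a \<le> i \<and> i \<le> b) \<longleftrightarrow> - int (length L) \<le> i \<and> i < int (max 1 (length R))"
  proof
    assume "\<exists>a\<in>?S. \<exists>b\<in>?S. a \<le> i \<and> i \<le> b"
    then obtain a b where "a \<in> ?S" "b \<in> ?S" "a \<le> i" "i \<le> b" by blast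
    then show "- int (length L) \<le> i \<and> i < int (max 1 (length R))"
      using bounds[of a] bounds[of b] by linarith
  next
    assume i: "- int (length L) \<le> i \<and> i < int (max 1 (length R))"
    show "\<exists>a\<in>?S. \<exists>b\<in>?S. a \<le> i \<and> i \<le> b"
    proof (cases "i = 0")
      case True
      then show ?thesis by auto
    next
      case False
      show ?thesis
      proof (cases "i > 0")
        case True
        then have "nat i < length R" using i by auto
        then have "sym_of (nth_void R (length R - 1)) \<noteq> None" "nat i \<le> length R - 1"
          using last_nonblank[OF R] by auto
        then have "int (length R - 1) \<in> ?S" "i \<le> int (length R - 1)"
          unfolding mem tape_of_def by (simp_all add: nat_le_iff)
        then show ?thesis using True by (intro bexI[of _ 0] bexI[of _ "int (length R - 1)"]) auto
      next
        case neg: False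
        with False i have "nat (-1 - i) < length L" by auto
        then have "sym_of (nth_void L (length L - 1)) \<noteq> None" "L \<noteq> []"
          using last_nonblank[OF L] by auto
        moreover have "nat (int (length L) - 1) = length L - 1" by arith
        ultimately have "- int (length L) \<in> ?S"
          unfolding mem tape_of_def by simp
        then show ?thesis using i neg
          by (intro bexI[of _ "- int (length L)"] bexI[of _ 0]) auto
      qed
    qed
  qed
  then have load: "load ?t i = (if - int (length L) \<le> i \<and> i < int (max 1 (length R))
      then Sym (sym_of (tape_of L R i)) else Void)"
    by (simp only: load_def Let_def cells_tape_of_halves)
  have sym: "Sym (sym_of (nth_void l n)) = nth_void l n"
    if "n < length l" "trimmed l" for l :: "'a work_symbol list" and n
  proof -
    have "l ! n \<in> range Sym" using that nth_mem[OF that(1)] unfolding trimmed_def by blast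
    then obtain a where "l ! n = Sym a" by blast
    then show ?thesis using that by (simp add: nth_void_def)
  qed
  have "max 1 (length R) = (if R = [] then 1 else length R)"
    by (cases R) auto
  note load = load[unfolded this]
  show "load ?t i = tape_of L (if R = [] then [Sym None] else R) i"
  proof (cases "i \<ge> 0")
    case True
    show ?thesis
    proof (cases "R = []")
      case True
      show ?thesis
      proof (cases "i = 0")
        case True
        then show ?thesis using load \<open>R = []\<close> by (simp add: tape_of_def nth_void_def)
      qed (use \<open>i \<ge> 0\<close> True load in \<open>simp add: tape_of_def nth_void_def\<close>)
    next
      case False
      show ?thesis
      proof (cases "nat i < length R")
        case True
        then have "i < int (length R)" using \<open>i \<ge> 0\<close> by linarith
        then show ?thesis using load False \<open>i \<ge> 0\<close> sym[OF True R] by (simp add: tape_of_def)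
      next
        case out: False
        then have "\<not> i < int (length R)" using \<open>i \<ge> 0\<close> by linarith
        then show ?thesis using load False \<open>i \<ge> 0\<close> out by (simp add: tape_of_def nth_void_def)
      qed
    qed
  next
    case False
    show ?thesis
    proof (cases "nat (-1 - i) < length L")
      case True
      then have "- int (length L) \<le> i" "i < 1" using False by linarith+
      then show ?thesis using load False sym[OF True L] by (simp add: tape_of_def)
    next
      case out: False
      then have "\<not> - int (length L) \<le> i" using False by linarith
      then show ?thesis using load False out by (simp add: tape_of_def nth_void_def)
    qed
  qed
qed

section \<open>Simulating a machine on two stacks\<close>

datatype track = Main | Work | Cand | Save | Ctl | Cnt

instance track :: finite
proof
  have "(UNIV :: track set) = {Main, Work, Cand, Save, Ctl, Cnt}"
    using track.exhaust by auto
  then show "finite (UNIV :: track set)" by (metis finite.emptyI finite_insert)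
qed

text \<open>\<open>InR\<close> and \<open>InL\<close> hold input and output, \<open>WorkR\<close>
  and \<open>WorkL\<close> the simulated tape, \<open>SaveR\<close> and \<open>SaveL\<close> the
  input to be compared with. \<open>Code\<close> is the current candidate and \<open>Temp\<close> is
  scratch space. \<open>State\<close> holds the simulated state and is empty after halting,
  \<open>Clock\<close> the steps still allowed, \<open>Again\<close> the request for another
  candidate. \<open>Flag\<close> records mismatches, or the carry of an increment.\<close>

abbreviation "InR \<equiv> (Main, True)"
abbreviation "InL \<equiv> (Main, False)"
abbreviation "WorkR \<equiv> (Work, True)"
abbreviation "WorkL \<equiv> (Work, False)"
abbreviation "Code \<equiv> (Cand, True)"
abbreviation "Temp \<equiv> (Cand, False)"
abbreviation "SaveR \<equiv> (Save, True)"
abbreviation "SaveL \<equiv> (Save, False)"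
abbreviation "State \<equiv> (Ctl, True)"
abbreviation "Again \<equiv> (Ctl, False)"
abbreviation "Clock \<equiv> (Cnt, True)"
abbreviation "Flag \<equiv> (Cnt, False)"

text \<open>The scanned cell is the top of \<open>r\<close>. Reading past the end of a list gives
  \<open>Void\<close>, so the lists are determined only up to trailing \<open>Void\<close> symbols,
  which a simulation does produce.\<close>

definition represents :: "int \<Rightarrow> (int \<Rightarrow> 's work_symbol) \<Rightarrow> 's work_symbol list \<Rightarrow> 's work_symbol list \<Rightarrow> bool" where
  "represents h w l r \<longleftrightarrow>
     (\<forall>n. w (h + int n) = nth_void r n) \<and> (\<forall>n. w (h - 1 - int n) = nth_void l n)"

lemma represents_tape_of: "represents 0 (tape_of l r) l r"
  by (auto simp: represents_def tape_of_def)

definition or_void :: "'s work_symbol option \<Rightarrow> 's work_symbol" where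
  "or_void v = (case v of None \<Rightarrow> Void | Some a \<Rightarrow> a)"

lemma or_void_peek: "or_void (peek l) = nth_void l 0"
  by (cases l) (auto simp: or_void_def)

lemma nth_void_tl: "nth_void (tl l) n = nth_void l (Suc n)"
  by (cases l) auto

text \<open>The current state \<open>e\<close> has already been taken off \<open>State\<close>. A
  new state is pushed only if the table has an entry, so halting is visible as an empty
  \<open>State\<close>.\<close>

definition sim_step :: "'s machine \<Rightarrow> 's work_symbol \<Rightarrow> (track, 's work_symbol) com" where
  "sim_step T e = (case e of Aux q \<Rightarrow> Pop WorkR (\<lambda>v.
     (case T (q, or_void v) of
        None \<Rightarrow> Push WorkR (or_void v)
      | Some (q', b, d) \<Rightarrow> Seq (Push State (Aux q')) (case d of
            Stay \<Rightarrow> Push WorkR b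
          | MoveRight \<Rightarrow> Push WorkL b
          | MoveLeft \<Rightarrow> Seq (Push WorkR b) (Pop WorkL (\<lambda>u. Push WorkR (or_void u))))))
   | _ \<Rightarrow> Skip)"

lemma represents_write:
  assumes "represents h w l r"
  shows "represents h (w(h := b)) l (b # tl r)"
  unfolding represents_def
proof (intro conjI allI)
  fix n
  show "(w(h := b)) (h + int n) = nth_void (b # tl r) n"
    using assms unfolding represents_def nth_void_tl[symmetric]
    by (cases n) (auto simp del: of_nat_Suc simp: nth_void_tl)
qed (use assms in \<open>auto simp: represents_def\<close>)

lemma represents_right:
  assumes "represents h w l (b # r)"
  shows "represents (h + 1) w (b # l) r"
  unfolding represents_def
proof (intro conjI allI)
  fix n
  show "w (h + 1 + int n) = nth_void r n"
    using assms unfolding represents_def by (metis nth_void_simps(3) of_nat_Suc add.assoc)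
  show "w (h + 1 - 1 - int n) = nth_void (b # l) n"
  proof (cases n)
    case 0
    then show ?thesis using assms unfolding represents_def
      by (metis add_diff_cancel_right' add.right_neutral diff_zero nth_void_simps(2) of_nat_0)
  next
    case (Suc m)
    then have "h + 1 - 1 - int n = h - 1 - int m" by simp
    then show ?thesis using assms unfolding represents_def Suc nth_void_simps by metis
  qed
qed

lemma represents_left:
  assumes "represents h w l r"
  shows "represents (h - 1) w (tl l) (nth_void l 0 # r)"
  unfolding represents_def
proof (intro conjI allI)
  fix n
  show "w (h - 1 - 1 - int n) = nth_void (tl l) n"
  proof -
    have "h - 1 - 1 - int n = h - 1 - int (Suc n)" by simp
    then show ?thesis using assms unfolding represents_def nth_void_tl by metis
  qed
  show "w (h - 1 + int n) = nth_void (nth_void l 0 # r) n"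
  proof (cases n)
    case 0
    then show ?thesis using assms unfolding represents_def
      by (metis add.right_neutral diff_zero nth_void_simps(2) of_nat_0)
  next
    case (Suc m)
    then have "h - 1 + int n = h + int m" by simp
    then show ?thesis using assms Suc unfolding represents_def by simp
  qed
qed

lemma scanned: "represents h w l r \<Longrightarrow> or_void (peek r) = w h"
  unfolding or_void_peek represents_def by (metis add.right_neutral of_nat_0)

lemma wp_sim_step_None:
  assumes r: "represents h w (s WorkL) (s WorkR)" and st: "step T (q, h, w) = None"
    and P: "\<And>l r. represents h w l r \<Longrightarrow> P (s(WorkL := l, WorkR := r))"
  shows "wp (sim_step T (Aux q)) s P"
proof -
  have T: "T (q, w h) = None" using st by (auto split: option.splits)
  have "represents h w (s WorkL) (w h # tl (s WorkR))"
    using represents_write[OF r, of "w h"] by simp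
  then have *: "P (s(WorkL := s WorkL, WorkR := w h # tl (s WorkR)))" by (rule P)
  show ?thesis
    unfolding sim_step_def work_symbol.case
    by (rule wp_Pop, simp only: scanned[OF r] T option.case, rule wp_Push,
        rule back_subst[of P, OF *], auto simp: fun_eq_iff)
qed

lemma wp_sim_step_Some:
  assumes r: "represents h w (s WorkL) (s WorkR)" and st: "step T (q, h, w) = Some (q', h', w')"
    and P: "\<And>l r. represents h' w' l r \<Longrightarrow> P (s(State := Aux q' # s State, WorkL := l, WorkR := r))"
  shows "wp (sim_step T (Aux q)) s P"
proof -
  obtain b d where T: "T (q, w h) = Some (q', b, d)" and h': "h' = h + offset d" and w': "w' = w(h := b)"
    using st by (auto split: option.splits)
  have r1: "represents h w' (s WorkL) (b # tl (s WorkR))"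
    unfolding w' by (rule represents_write[OF r])
  show ?thesis
  proof (cases d)
    case Stay
    have *: "P (s(State := Aux q' # s State, WorkL := s WorkL, WorkR := b # tl (s WorkR)))"
      using r1 h' Stay by (intro P) simp
    show ?thesis
      unfolding sim_step_def work_symbol.case
      by (rule wp_Pop, simp only: scanned[OF r] T Stay option.case prod.case move.case,
          rule wp_Seq, rule wp_Push, rule wp_Push, rule back_subst[of P, OF *],
          auto simp: fun_eq_iff or_void_peek)
  next
    case MoveRight
    have *: "P (s(State := Aux q' # s State, WorkL := b # s WorkL, WorkR := tl (s WorkR)))"
      using represents_right[OF r1] h' MoveRight by (intro P) simp
    show ?thesis
      unfolding sim_step_def work_symbol.case
      by (rule wp_Pop, simp only: scanned[OF r] T MoveRight option.case prod.case move.case,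
          rule wp_Seq, rule wp_Push, rule wp_Push, rule back_subst[of P, OF *],
          auto simp: fun_eq_iff or_void_peek)
  next
    case MoveLeft
    have *: "P (s(State := Aux q' # s State, WorkL := tl (s WorkL),
        WorkR := nth_void (s WorkL) 0 # b # tl (s WorkR)))"
      using represents_left[OF r1] h' MoveLeft by (intro P) simp
    show ?thesis
      unfolding sim_step_def work_symbol.case
      by (rule wp_Pop, simp only: scanned[OF r] T MoveLeft option.case prod.case move.case,
          rule wp_Seq, rule wp_Push, rule wp_Seq, rule wp_Push, rule wp_Pop, rule wp_Push, rule back_subst[of P, OF *],
          auto simp: fun_eq_iff or_void_peek)
  qed
qed

text \<open>The lookup that finds no entry is counted too, so a halted configuration needs bound 1.
  This is the count of \<open>sim_bounded\<close>, which spends one clock symbol on every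
  lookup.\<close>

fun halts_within :: "'s machine \<Rightarrow> nat \<Rightarrow> 's config \<Rightarrow> bool" where
  "halts_within T 0 c = False"
| "halts_within T (Suc n) c = (case step T c of None \<Rightarrow> True | Some c' \<Rightarrow> halts_within T n c')"

lemma halts_withinD: "halts_within T n c \<Longrightarrow> \<exists>c'. halts_in T c c'"
proof (induction n arbitrary: c)
  case (Suc n)
  show ?case
  proof (cases "step T c")
    case None
    then have "halts_in T c c" unfolding halts_in_def by blast
    then show ?thesis by blast
  next
    case (Some c')
    then have "halts_within T n c'" using Suc.prems by simp
    then obtain c'' where "halts_in T c' c''" using Suc.IH by blast
    then show ?thesis using Some unfolding halts_in_def
      by (intro exI[of _ c'']) (auto intro: converse_rtranclp_into_rtranclp)
  qed
qed simp

text \<open>Stated for all large bounds, because the length of a code of a tape will be controlled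
  only from below.\<close>

lemma halts_in_within:
  assumes "halts_in T c c'"
  shows "\<exists>n0. \<forall>n\<ge>n0. halts_within T n c"
proof -
  have "(\<lambda>d d'. step T d = Some d')\<^sup>*\<^sup>* c c'" "step T c' = None"
    using assms by (auto simp: halts_in_def)
  then show ?thesis
  proof (induction rule: converse_rtranclp_induct)
    case base
    have "halts_within T n c'" if "n \<ge> 1" for n using that base by (cases n) auto
    then show ?case by blast
  next
    case (step d d')
    then obtain n0 where n0: "\<forall>n\<ge>n0. halts_within T n d'" by blast
    have "halts_within T n d" if "n \<ge> Suc n0" for n using that n0 step by (cases n) auto
    then show ?case by blast
  qed
qed

text \<open>After halting, the remaining clock symbols are drained by idle rounds:
  \<open>State\<close> yields \<open>None\<close> and nothing is done. Hence \<open>Clock\<close> is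
  always empty at the end and the verdict is left in \<open>State\<close>.\<close>

definition sim_bounded :: "'s machine \<Rightarrow> (track, 's work_symbol) com" where
  "sim_bounded T = Drain Clock (\<lambda>_. Pop State (\<lambda>v. case v of None \<Rightarrow> Skip | Some e \<Rightarrow> sim_step T e))"

lemma wp_sim_bounded_halted:
  assumes "s State = []" "P (s(Clock := []))"
  shows "wp (sim_bounded T) s P"
  using assms
proof (induction "s Clock" arbitrary: s)
  case Nil
  then have "s(Clock := []) = s" by (auto simp: fun_eq_iff)
  with Nil show ?case unfolding sim_bounded_def by (intro wp_Drain_Nil) auto
next
  case (Cons e l)
  have "s(Clock := l, State := []) = s(Clock := l)" using Cons.prems by (auto simp: fun_eq_iff)
  moreover have "wp (sim_bounded T) (s(Clock := l)) P"
    by (rule Cons.hyps(1)) (use Cons in auto)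
  ultimately show ?case unfolding sim_bounded_def using Cons.hyps(2)[symmetric] Cons.prems(1)
    by (intro wp_Drain_Cons wp_Pop) (auto intro!: wp_Skip)
qed

lemma wp_sim_bounded:
  assumes "represents h w (s WorkL) (s WorkR)" "s State = [Aux q]"
    and "\<And>l r q'. P (s(Clock := [], WorkL := l, WorkR := r,
        State := if halts_within T (length (s Clock)) (q, h, w) then [] else [Aux q']))"
  shows "wp (sim_bounded T) s P"
  using assms
proof (induction "s Clock" arbitrary: s q h w)
  case Nil
  have *: "s(Clock := [], WorkL := s WorkL, WorkR := s WorkR, State := [Aux q]) = s"
    using Nil by (auto simp: fun_eq_iff)
  have "halts_within T (length (s Clock)) (q, h, w) = False" using Nil.hyps[symmetric] by simp
  with Nil.prems(3)[of "s WorkL" "s WorkR" q] have "P s" by (simp only: * if_False)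
  with Nil.hyps show ?case unfolding sim_bounded_def by (intro wp_Drain_Nil) auto
next
  case (Cons e cl)
  let ?s = "s(Clock := cl, State := [])"
  have rep: "represents h w (?s WorkL) (?s WorkR)" using Cons.prems by simp
  have "wp (sim_step T (Aux q)) ?s (\<lambda>s'. wp (sim_bounded T) s' P)"
  proof (cases "step T (q, h, w)")
    case None
    show ?thesis
    proof (rule wp_sim_step_None[OF rep None], rule wp_sim_bounded_halted)
      fix l r
      have "?s(WorkL := l, WorkR := r, Clock := []) = s(Clock := [], WorkL := l, WorkR := r, State := [])"
        by (auto simp: fun_eq_iff)
      then show "P (?s(WorkL := l, WorkR := r, Clock := []))"
        using Cons.prems(3)[of l r] None Cons.hyps(2)[symmetric] by simp
    qed simp
  next
    case (Some c')
    obtain q' h' w' where c': "c' = (q', h', w')" by (cases c')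
    show ?thesis
    proof (rule wp_sim_step_Some[OF rep Some[unfolded c']])
      fix l r
      assume r: "represents h' w' l r"
      let ?s' = "?s(State := Aux q' # ?s State, WorkL := l, WorkR := r)"
      show "wp (sim_bounded T) ?s' P"
      proof (rule Cons.hyps(1)[of ?s' h' w' q'])
        fix l' r' q''
        have "?s'(Clock := [], WorkL := l', WorkR := r', State := z)
          = s(Clock := [], WorkL := l', WorkR := r', State := z)" for z
          by (auto simp: fun_eq_iff)
        then show "P (?s'(Clock := [], WorkL := l', WorkR := r',
            State := if halts_within T (length (?s' Clock)) (q', h', w') then [] else [Aux q'']))"
          using Cons.prems(3)[of l' r' q''] Some c' Cons.hyps(2)[symmetric] by simp
      qed (use r in auto)
    qed
  qed
  then show ?case unfolding sim_bounded_def using Cons.hyps(2)[symmetric] Cons.prems(2)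
    by (intro wp_Drain_Cons wp_Pop) auto
qed

text \<open>The loop is controlled by \<open>State\<close>, which every simulated move refills; it
  terminates only if the simulated machine halts.\<close>

definition sim_run :: "'s machine \<Rightarrow> (track, 's work_symbol) com" where
  "sim_run T = Drain State (sim_step T)"

lemma wp_sim_run:
  assumes "halts_in T (q, h, w) (q', h', w')"
    and "represents h w (s WorkL) (s WorkR)" "s State = [Aux q]"
    and "\<And>l r. represents h' w' l r \<Longrightarrow> P (s(WorkL := l, WorkR := r, State := []))"
  shows "wp (sim_run T) s P"
proof -
  have "(\<lambda>d d'. step T d = Some d')\<^sup>*\<^sup>* (q, h, w) (q', h', w')" "step T (q', h', w') = None"
    using assms by (auto simp: halts_in_def)
  then show ?thesis using assms(2-)
  proof (induction "(q, h, w)" arbitrary: q h w s rule: converse_rtranclp_induct)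
    case base
    have "wp (sim_step T (Aux q')) (s(State := [])) (\<lambda>s'. wp (sim_run T) s' P)"
    proof (rule wp_sim_step_None)
      fix l r assume r: "represents h' w' l r"
      have "s(State := [], WorkL := l, WorkR := r) = s(WorkL := l, WorkR := r, State := [])"
        by (auto simp: fun_eq_iff)
      then show "wp (sim_run T) (s(State := [], WorkL := l, WorkR := r)) P"
        unfolding sim_run_def using base.prems(4)[OF r] by (intro wp_Drain_Nil) auto
    qed (use base in auto)
    then show ?case unfolding sim_run_def using base by (intro wp_Drain_Cons) auto
  next
    case (step c)
    obtain q1 h1 w1 where c: "c = (q1, h1, w1)" by (cases c)
    have "wp (sim_step T (Aux q)) (s(State := [])) (\<lambda>s'. wp (sim_run T) s' P)"
    proof (rule wp_sim_step_Some)
      show "step T (q, h, w) = Some (q1, h1, w1)" using step.hyps(1) c by simp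
      fix l r assume r: "represents h1 w1 l r"
      let ?s = "s(State := [], State := Aux q1 # (s(State := [])) State, WorkL := l, WorkR := r)"
      show "wp (sim_run T) ?s P"
      proof (rule step.hyps(3)[OF c])
        fix l' r' assume r': "represents h' w' l' r'"
        have "?s(WorkL := l', WorkR := r', State := []) = s(WorkL := l', WorkR := r', State := [])"
          by (auto simp: fun_eq_iff)
        then show "P (?s(WorkL := l', WorkR := r', State := []))"
          using step.prems(4)[OF r'] by simp
      qed (use r step.prems in auto)
    qed (use step in auto)
    then show ?case unfolding sim_run_def using step by (intro wp_Drain_Cons) auto
  qed
qed

section \<open>Enumerating the candidates\<close>

text \<open>Reading a list as a numeral in bijective base \<open>b\<close>, least significant digit first,
  turns \<open>successor\<close> into the increment of \<open>val\<close>.\<close>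

locale enumeration =
  fixes A :: "'e set" and ix :: "'e \<Rightarrow> nat" and b :: nat
  assumes bij: "bij_betw ix A {..<b}" and b_pos: "b > 0"
begin

definition el :: "nat \<Rightarrow> 'e" where
  "el = inv_into A ix"

primrec successor :: "'e list \<Rightarrow> 'e list" where
  "successor [] = [el 0]"
| "successor (e # c) = (if Suc (ix e) < b then el (Suc (ix e)) # c else el 0 # successor c)"

primrec val :: "'e list \<Rightarrow> nat" where
  "val [] = 0"
| "val (e # c) = Suc (ix e) + b * val c"

lemma ix_el: "i < b \<Longrightarrow> ix (el i) = i"
  unfolding el_def using bij by (intro f_inv_into_f) (auto simp: bij_betw_def)

lemma el_in: "i < b \<Longrightarrow> el i \<in> A"
  unfolding el_def using bij by (intro inv_into_into) (auto simp: bij_betw_def)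

lemma ix_less: "e \<in> A \<Longrightarrow> ix e < b"
  using bij by (auto simp: bij_betw_def)

lemma successor_in: "c \<in> lists A \<Longrightarrow> successor c \<in> lists A"
  by (induction c) (use el_in b_pos in auto)

lemma val_successor: "c \<in> lists A \<Longrightarrow> val (successor c) = Suc (val c)"
proof (induction c)
  case Nil
  then show ?case using ix_el b_pos by simp
next
  case (Cons e c)
  then have e: "e \<in> A" and IH: "val (successor c) = Suc (val c)" by auto
  show ?case
  proof (cases "Suc (ix e) < b")
    case True
    then show ?thesis using ix_el by simp
  next
    case False
    then have "Suc (ix e) = b" using ix_less[OF e] by simp
    then show ?thesis using ix_el[of 0] b_pos IH False by simp
  qed
qed

text \<open>Digits have the values 1 to \<open>b\<close>, so there are no leading zeros and only the
  empty list has value 0. The first digit is recovered modulo \<open>b\<close>, the remaining list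
  from the quotient.\<close>

lemma val_inj:
  assumes "c \<in> lists A" "d \<in> lists A" "val c = val d"
  shows "c = d"
  using assms
proof (induction c arbitrary: d rule: list.induct)
  case Nil
  then show ?case by (cases d) auto
next
  case (Cons e c)
  then obtain e' d' where d: "d = e' # d'" by (cases d) auto
  have "e # c \<in> lists A" "e' # d' \<in> lists A" using Cons.prems(1,2) d by simp_all
  then have e: "e \<in> A" "e' \<in> A" and cd: "c \<in> lists A" "d' \<in> lists A" by simp_all
  have eq: "ix e + b * val c = ix e' + b * val d'" using Cons.prems d by simp
  have "(ix e + b * val c) mod b = ix e" "(ix e' + b * val d') mod b = ix e'"
    using ix_less e by auto
  then have ix: "ix e = ix e'" using eq by simp
  then have "val c = val d'" using eq b_pos by simp
  moreover have "e = e'" using ix e bij by (auto simp: bij_betw_def inj_on_def)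
  ultimately show ?case using Cons.IH cd d by auto
qed

text \<open>The iterates of \<open>successor\<close> from the empty list take the values 0, 1, 2,
  ..., so the iterate with the value of \<open>c\<close> is \<open>c\<close> by injectivity.\<close>

lemma successor_reaches:
  assumes "c \<in> lists A"
  shows "(successor ^^ val c) [] = c"
proof -
  have "(successor ^^ n) [] \<in> lists A \<and> val ((successor ^^ n) []) = n" for n
  proof (induction n)
    case (Suc n)
    then show ?case using successor_in val_successor by (metis comp_apply funpow.simps(2))
  qed simp
  then show ?thesis using assms val_inj by metis
qed

end

section \<open>Building tapes from instruction lists\<close>

fun place :: "'s work_symbol \<Rightarrow> 's work_symbol list \<times> 's work_symbol list
    \<Rightarrow> 's work_symbol list \<times> 's work_symbol list" where
  "place (Sym a) (l, r) = (l, trim_Cons (Sym a) r)"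
| "place _ (l, r) = (trim_Cons (case peek r of None \<Rightarrow> Sym None | Some e \<Rightarrow> e) l, tl r)"

text \<open>A list of symbols is read backwards, as instructions for a head that inserts
  a cell under itself (\<open>Sym a\<close>) or moves one cell to the right (\<open>Void\<close>).\<close>

definition left_half :: "'s work_symbol list \<Rightarrow> 's work_symbol list" where
  "left_half c = fst (fold place (rev c) ([], []))"

definition right_half :: "'s work_symbol list \<Rightarrow> 's work_symbol list" where
  "right_half c = (let r = snd (fold place (rev c) ([], [])) in if r = [] then [Sym None] else r)"

definition decode :: "'s work_symbol list \<Rightarrow> 's tape" where
  "decode c = tape_of_halves (left_half c) (snd (fold place (rev c) ([], [])))"

text \<open>Trimming at each instruction keeps both halves in normal form throughout, so any list
  whatever decodes to a tape and no final clean-up is needed.\<close>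

lemma trimmed_place:
  assumes "trimmed (fst p)" "trimmed (snd p)"
  shows "trimmed (fst (place e p)) \<and> trimmed (snd (place e p))"
proof -
  obtain l r where p: "p = (l, r)" by (cases p)
  have "(case peek r of None \<Rightarrow> Sym None | Some e \<Rightarrow> e) \<in> range Sym"
    using assms p by (cases r) (auto simp: trimmed_def)
  then show ?thesis unfolding p
    by (cases e) (use assms p in \<open>auto intro: trimmed_trim_Cons trimmed_tl\<close>)
qed

lemma trimmed_fold_place:
  "trimmed (fst p) \<Longrightarrow> trimmed (snd p) \<Longrightarrow>
    trimmed (fst (fold place c p)) \<and> trimmed (snd (fold place c p))"
proof (induction c arbitrary: p)
  case (Cons e c)
  then show ?case using trimmed_place[of p e] Cons.IH[of "place e p"] by simp
qed simp

lemma load_decode: "load (decode c) = tape_of (left_half c) (right_half c)"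
  unfolding decode_def left_half_def right_half_def Let_def
  by (rule load_tape_of_halves) (use trimmed_fold_place[of "([], [])"] trimmed_Nil in auto)

lemma set_left_half: "set (left_half c) \<subseteq> range Sym"
  using trimmed_fold_place[of "([], [])" "rev c"] trimmed_Nil
  by (auto simp: left_half_def trimmed_def)

lemma set_right_half: "set (right_half c) \<subseteq> range Sym"
  using trimmed_fold_place[of "([], [])" "rev c"] trimmed_Nil
  by (auto simp: right_half_def Let_def trimmed_def)

text \<open>Moving right on a blank tape only shifts a blank to the left half, where it is trimmed.
  This is the padding that makes codes as long as desired.\<close>

lemma fold_place_Void: "fold place (replicate n Void) ([], []) = ([], [])"
  by (induction n) (auto simp: trim_Cons_def)

text \<open>Inserting a cell and stepping over it transfers one symbol to the left half. For a blank
  the insertion is trimmed away, but the move then reads the missing cell as a blank, with the same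
  effect.\<close>

lemma fold_place_left:
  "set es \<subseteq> range Sym \<Longrightarrow>
    fold place (concat (map (\<lambda>e. [e, Void]) es)) (l, []) = (fold trim_Cons es l, [])"
proof (induction es arbitrary: l)
  case (Cons e es)
  then obtain a where e: "e = Sym a" by auto
  have "place Void (place e (l, [])) = (trim_Cons e l, [])"
    unfolding e by (cases a) (auto simp: trim_Cons_def)
  then show ?case using Cons by simp
qed simp

lemma fold_place_right:
  "set es \<subseteq> range Sym \<Longrightarrow> fold place es (l, r) = (l, fold trim_Cons es r)"
  by (induction es arbitrary: r) auto

text \<open>Only outermost blanks are lost by trimming, and past the end of a list
  \<open>sym_of\<close> reads \<open>None\<close> anyway.\<close>

lemma sym_of_foldr_trim_Cons:
  "sym_of (nth_void (foldr trim_Cons l []) n) = sym_of (nth_void l n)"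
proof (induction l arbitrary: n)
  case (Cons e l)
  show ?case
  proof (cases "e = Sym None \<and> foldr trim_Cons l [] = []")
    case True
    then have "sym_of (nth_void (foldr trim_Cons (e # l) []) n) = None"
      by (simp add: trim_Cons_def)
    moreover have "sym_of (nth_void (e # l) n) = None"
    proof (cases n)
      case (Suc m)
      then show ?thesis using Cons[of m] True by simp
    qed (use True in simp)
    ultimately show ?thesis by simp
  next
    case False
    then have "foldr trim_Cons (e # l) [] = e # foldr trim_Cons l []"
      by (auto simp: trim_Cons_def)
    then show ?thesis using Cons by (cases n) auto
  qed
qed simp

lemma decode_surj:
  fixes t :: "'s tape"
  shows "\<exists>c. set c \<subseteq> insert Void (range Sym) \<and> n \<le> length c \<and> decode c = t"
proof -
  have "finite (dom (cells t))" using cells[of t] by simp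
  then have "finite ((\<lambda>i. nat \<bar>i\<bar>) ` dom (cells t))" by simp
  then obtain m0 where m0: "\<forall>k\<in>(\<lambda>i. nat \<bar>i\<bar>) ` dom (cells t). k \<le> m0"
    using finite_nat_set_iff_bounded_le by blast
  define m where "m = Suc m0"
  have out: "cells t i = None" if "i < - int m \<or> i \<ge> int m" for i
    using m0 that unfolding m_def by (cases "cells t i") force+
  define L where "L = map (\<lambda>k. Sym (cells t (-1 - int k))) [0..<m]"
  define R where "R = map (\<lambda>k. Sym (cells t (int k))) [0..<m]"
  \<comment> \<open>In order of execution: padding, then the left cells from -m to -1, each stepped
    over, then the right cells from m - 1 down to 0, each inserted in front of the previous ones. As
    codes are read backwards, the code is \<open>rev p\<close>.\<close>
  define p where "p = replicate n Void @ concat (map (\<lambda>e. [e, Void]) (rev L)) @ rev R"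
  have LR: "set (rev L) \<subseteq> range Sym" "set (rev R) \<subseteq> range Sym"
    by (auto simp: L_def R_def)
  have p: "fold place p ([], []) = (foldr trim_Cons L [], foldr trim_Cons R [])"
    unfolding p_def fold_append comp_apply fold_place_Void fold_place_left[OF LR(1)]
      fold_place_right[OF LR(2)] foldr_conv_fold ..
  have "cells (decode (rev p)) i = cells t i" for i
  proof (cases "i \<ge> 0")
    case True
    then have "cells (decode (rev p)) i = sym_of (nth_void R (nat i))"
      by (simp add: decode_def left_half_def p cells_tape_of_halves tape_of_def sym_of_foldr_trim_Cons)
    also have "\<dots> = cells t i"
      using True out[of i] by (auto simp: R_def nth_void_def)
    finally show ?thesis .
  next
    case False
    then have "cells (decode (rev p)) i = sym_of (nth_void L (nat (-1 - i)))"
      by (simp add: decode_def left_half_def p cells_tape_of_halves tape_of_def sym_of_foldr_trim_Cons)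
    also have "\<dots> = cells t i"
      using False out[of i] by (auto simp: L_def nth_void_def)
    finally show ?thesis .
  qed
  then have "decode (rev p) = t" by (simp add: cells_inject[symmetric] fun_eq_iff)
  moreover have "set (rev p) \<subseteq> insert Void (range Sym)" by (auto simp: p_def L_def R_def)
  moreover have "n \<le> length (rev p)" by (simp add: p_def)
  ultimately show ?thesis by blast
qed

section \<open>The search program\<close>

text \<open>The stack version of \<open>trim_Cons\<close>: emptiness is tested by popping the top
  and putting it back.\<close>

definition push_trimmed :: "'k \<times> bool \<Rightarrow> 's work_symbol \<Rightarrow> ('k, 's work_symbol) com" where
  "push_trimmed k e = (if e = Sym None
     then Pop k (\<lambda>v. case v of None \<Rightarrow> Skip | Some e' \<Rightarrow> Seq (Push k e') (Push k e))
     else Push k e)"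

lemma wp_push_trimmed:
  assumes "P (s(k := trim_Cons e (s k)))"
  shows "wp (push_trimmed k e) s P"
proof (cases "e = Sym None")
  case True
  show ?thesis
  proof (cases "s k")
    case Nil
    then have "s(k := trim_Cons e (s k)) = s(k := tl (s k))" using True by (simp add: trim_Cons_def)
    then have "P (s(k := tl (s k)))" using assms by simp
    then show ?thesis unfolding push_trimmed_def using True Nil
      by (auto intro!: wp_Pop wp_Skip)
  next
    case (Cons e' l)
    have "P (s(k := e # e' # l))" using assms Cons by (simp add: trim_Cons_def)
    then show ?thesis unfolding push_trimmed_def using True Cons
      by (auto intro!: wp_Pop wp_Push wp_Seq)
  qed
next
  case False
  then show ?thesis using assms unfolding push_trimmed_def
    by (auto intro!: wp_Push simp: trim_Cons_def)
qed

definition place_prog :: "'s work_symbol \<Rightarrow> (track, 's work_symbol) com" where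
  "place_prog e = (case e of Sym a \<Rightarrow> push_trimmed WorkR e
     | _ \<Rightarrow> Pop WorkR (\<lambda>v. push_trimmed WorkL (case v of None \<Rightarrow> Sym None | Some e' \<Rightarrow> e')))"

lemma wp_place_prog:
  assumes "place e (s WorkL, s WorkR) = (l, r)" "P (s(WorkL := l, WorkR := r))"
  shows "wp (place_prog e) s P"
proof (cases "\<exists>a. e = Sym a")
  case True
  then obtain a where e: "e = Sym a" by blast
  have "s(WorkL := l, WorkR := r) = s(WorkR := trim_Cons e (s WorkR))"
    using assms(1) e by (auto simp: fun_eq_iff)
  then have "P (s(WorkR := trim_Cons e (s WorkR)))" using assms(2) by simp
  then show ?thesis unfolding place_prog_def e by (auto intro: wp_push_trimmed)
next
  case False
  let ?e = "case peek (s WorkR) of None \<Rightarrow> Sym None | Some e' \<Rightarrow> e'"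
  have lr: "l = trim_Cons ?e (s WorkL)" "r = tl (s WorkR)"
    using assms(1) False by (cases e; auto)+
  have *: "P (s(WorkL := l, WorkR := r))" by (rule assms(2))
  have "wp (push_trimmed WorkL ?e) (s(WorkR := tl (s WorkR))) P"
    by (rule wp_push_trimmed, rule back_subst[of P, OF *]) (auto simp: fun_eq_iff lr)
  then have "wp (Pop WorkR (\<lambda>v. push_trimmed WorkL (case v of None \<Rightarrow> Sym None | Some e' \<Rightarrow> e'))) s P"
    by (rule wp_Pop)
  then show ?thesis unfolding place_prog_def using False by (cases e) auto
qed

text \<open>Moving \<open>Code\<close> to \<open>Temp\<close> reverses it, which gives the backward
  reading; draining \<open>Temp\<close> restores \<open>Code\<close> and copies it to
  \<open>Clock\<close>, so the bound is the length of the code. The last pop and push supply the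
  blank in cell 0 for an empty right half.\<close>

definition decode_prog :: "(track, 's work_symbol) com" where
  "decode_prog = Seq (move_stack Code Temp)
     (Seq (Drain Temp (\<lambda>e. Seq (Push Code e) (Seq (Push Clock e) (place_prog e))))
       (Pop WorkR (\<lambda>v. Push WorkR (case v of None \<Rightarrow> Sym None | Some e \<Rightarrow> e))))"

lemma wp_decode_loop:
  assumes "fold place (s Temp) (s WorkL, s WorkR) = (l, r)"
    and "P (s(Temp := [], Code := rev (s Temp) @ s Code, Clock := rev (s Temp) @ s Clock,
      WorkL := l, WorkR := r))"
  shows "wp (Drain Temp (\<lambda>e. Seq (Push Code e) (Seq (Push Clock e) (place_prog e)))) s P"
  using assms
proof (induction "s Temp" arbitrary: s)
  case Nil
  have *: "P (s(Temp := [], Code := rev (s Temp) @ s Code, Clock := rev (s Temp) @ s Clock,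
      WorkL := l, WorkR := r))" by (rule Nil.prems(2))
  have "P s" by (rule back_subst[of P, OF *]) (use Nil in \<open>auto simp: fun_eq_iff\<close>)
  with Nil.hyps show ?case by (intro wp_Drain_Nil) auto
next
  case (Cons e c)
  note c = Cons.hyps(2)[symmetric]
  obtain l1 r1 where p: "place e (s WorkL, s WorkR) = (l1, r1)" by fastforce
  let ?s = "s(Temp := c, Code := e # s Code, Clock := e # s Clock, WorkL := l1, WorkR := r1)"
  have *: "P (s(Temp := [], Code := rev (s Temp) @ s Code, Clock := rev (s Temp) @ s Clock,
      WorkL := l, WorkR := r))" by (rule Cons.prems(2))
  have IH: "wp (Drain Temp (\<lambda>e. Seq (Push Code e) (Seq (Push Clock e) (place_prog e)))) ?s P"
  proof (rule Cons.hyps(1))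
    show "fold place (?s Temp) (?s WorkL, ?s WorkR) = (l, r)" using Cons.prems(1) c p by simp
    show "P (?s(Temp := [], Code := rev (?s Temp) @ ?s Code, Clock := rev (?s Temp) @ ?s Clock,
      WorkL := l, WorkR := r))"
      by (rule back_subst[of P, OF *]) (use c in \<open>auto simp: fun_eq_iff\<close>)
  qed simp
  show ?case
    by (rule wp_Drain_Cons, rule c, rule wp_Seq, rule wp_Push, rule wp_Seq, rule wp_Push,
        rule wp_place_prog[where l = l1 and r = r1], use p in simp,
        rule back_subst[of "\<lambda>s. wp _ s P", OF IH], auto simp: fun_eq_iff)
qed

lemma wp_decode_prog:
  assumes "s Temp = []" "s WorkL = []" "s WorkR = []"
    and P: "P (s(Clock := s Code @ s Clock, WorkL := left_half (s Code), WorkR := right_half (s Code)))"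
  shows "wp decode_prog s P"
proof -
  let ?p = "fold place (rev (s Code)) ([], [])"
  show ?thesis
    unfolding decode_prog_def
    by (rule wp_Seq, rule wp_move_stack, simp, rule wp_Seq,
        rule wp_decode_loop[where l = "fst ?p" and r = "snd ?p"], use assms(1-3) in simp,
        rule wp_Pop, rule wp_Push, rule back_subst[of P, OF P],
        cases "snd ?p") (auto simp: fun_eq_iff assms(1) left_half_def right_half_def)
qed

text \<open>The simulated stack \<open>a\<close> is consumed, whereas the reference \<open>t\<close>
  passes through \<open>temp\<close> and is restored for later candidates. What remains of
  \<open>a\<close> after \<open>t\<close> is exhausted may consist of \<open>Void\<close> only,
  since a simulation leaves trailing \<open>Void\<close> symbols.\<close>

definition compare :: "'k \<times> bool \<Rightarrow> 'k \<times> bool \<Rightarrow> 'k \<times> bool \<Rightarrow> 'k \<times> bool \<Rightarrow> ('k, 's work_symbol) com" where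
  "compare temp flag a t =
     Seq (Drain t (\<lambda>e. Seq (Push temp e) (Pop a (\<lambda>v. if v = Some e then Skip else Push flag Void))))
       (Seq (Drain a (\<lambda>e. if e = Void then Skip else Push flag Void)) (move_stack temp t))"

lemma wp_compare_prefix:
  fixes s :: "('k, 's work_symbol) store"
  assumes d: "distinct [a, t, temp, flag]"
    and "\<And>f :: 's work_symbol list. (f = [] \<longleftrightarrow> take (length (s t)) (s a) = s t) \<Longrightarrow>
      P (s(t := [], temp := rev (s t) @ s temp, a := drop (length (s t)) (s a), flag := f @ s flag))"
  shows "wp (Drain t (\<lambda>e. Seq (Push temp e) (Pop a (\<lambda>v. if v = Some e then Skip else Push flag Void)))) s P"
  using assms(2)
proof (induction "s t" arbitrary: s)
  case Nil
  have *: "P (s(t := [], temp := rev (s t) @ s temp, a := drop (length (s t)) (s a), flag := [] @ s flag))"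
    by (rule Nil.prems) (simp add: Nil.hyps[symmetric])
  have "P s" by (rule back_subst[of P, OF *]) (use Nil.hyps in \<open>auto simp: fun_eq_iff\<close>)
  with Nil.hyps show ?case by (intro wp_Drain_Nil) auto
next
  case (Cons e l)
  note l = Cons.hyps(2)[symmetric]
  let ?c = "Drain t (\<lambda>e. Seq (Push temp e) (Pop a (\<lambda>v. if v = Some e then Skip else Push flag Void)))"
  define g where "g = (if peek (s a) = Some e then [] else [Void :: 's work_symbol])"
  let ?s = "s(t := l, temp := e # s temp, a := tl (s a), flag := g @ s flag)"
  have IH: "wp ?c ?s P"
  proof (rule Cons.hyps(1))
    show "l = ?s t" using d by auto
    fix f :: "'s work_symbol list" assume f: "f = [] \<longleftrightarrow> take (length (?s t)) (?s a) = ?s t"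
    have *: "P (s(t := [], temp := rev (s t) @ s temp, a := drop (length (s t)) (s a), flag := (f @ g) @ s flag))"
      by (rule Cons.prems) (use f d l in \<open>cases "s a"; auto simp: g_def\<close>)
    show "P (?s(t := [], temp := rev (?s t) @ ?s temp, a := drop (length (?s t)) (?s a), flag := f @ ?s flag))"
      by (rule back_subst[of P, OF *]) (use d l in \<open>cases "s a"; auto simp: fun_eq_iff\<close>)
  qed
  have eq: "s(t := l, temp := e # (s(t := l)) temp, a := tl ((s(t := l, temp := e # (s(t := l)) temp)) a))
      = s(t := l, temp := e # s temp, a := tl (s a))"
    using d by (auto simp: fun_eq_iff)
  have pk: "peek ((s(t := l, temp := e # (s(t := l)) temp)) a) = peek (s a)" using d by simp
  have *: "wp (if peek (s a) = Some e then Skip else Push flag Void)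
     (s(t := l, temp := e # s temp, a := tl (s a))) (\<lambda>s'. wp ?c s' P)"
  proof (cases "peek (s a) = Some e")
    case True
    have "wp ?c (s(t := l, temp := e # s temp, a := tl (s a))) P"
      by (rule back_subst[of "\<lambda>s. wp ?c s P", OF IH]) (use d True in \<open>auto simp: fun_eq_iff g_def\<close>)
    then show ?thesis using True by (auto intro: wp_Skip)
  next
    case False
    have "wp (Push flag Void) (s(t := l, temp := e # s temp, a := tl (s a))) (\<lambda>s'. wp ?c s' P)"
      by (rule wp_Push, rule back_subst[of "\<lambda>s. wp ?c s P", OF IH])
        (use d False in \<open>auto simp: fun_eq_iff g_def\<close>)
    then show ?thesis using False by simp
  qed
  show ?case
    by (rule wp_Drain_Cons, rule l, rule wp_Seq, rule wp_Push, rule wp_Pop, simp only: eq pk, rule *)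
qed

lemma wp_compare_rest:
  fixes s :: "('k, 's work_symbol) store"
  assumes d: "a \<noteq> flag"
    and "\<And>f :: 's work_symbol list. (f = [] \<longleftrightarrow> set (s a) \<subseteq> {Void}) \<Longrightarrow> P (s(a := [], flag := f @ s flag))"
  shows "wp (Drain a (\<lambda>e. if e = Void then Skip else Push flag Void)) s P"
  using assms(2)
proof (induction "s a" arbitrary: s)
  case Nil
  have *: "P (s(a := [], flag := [] @ s flag))"
    by (rule Nil.prems) (simp add: Nil.hyps[symmetric])
  have "P s" by (rule back_subst[of P, OF *]) (use Nil.hyps in \<open>auto simp: fun_eq_iff\<close>)
  with Nil.hyps show ?case by (intro wp_Drain_Nil) auto
next
  case (Cons e l)
  note l = Cons.hyps(2)[symmetric]
  let ?c = "Drain a (\<lambda>e. if e = Void then Skip else Push flag Void)"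
  define g where "g = (if e = Void then [] else [Void :: 's work_symbol])"
  let ?s = "s(a := l, flag := g @ s flag)"
  have IH: "wp ?c ?s P"
  proof (rule Cons.hyps(1))
    show "l = ?s a" using d by simp
    fix f :: "'s work_symbol list" assume f: "f = [] \<longleftrightarrow> set (?s a) \<subseteq> {Void}"
    have *: "P (s(a := [], flag := (f @ g) @ s flag))"
      by (rule Cons.prems) (use f d l in \<open>auto simp: g_def\<close>)
    show "P (?s(a := [], flag := f @ ?s flag))"
      by (rule back_subst[of P, OF *]) (use d l in \<open>auto simp: fun_eq_iff\<close>)
  qed
  have *: "wp (if e = Void then Skip else Push flag Void) (s(a := l)) (\<lambda>s'. wp ?c s' P)"
  proof (cases "e = Void")
    case True
    have "wp ?c (s(a := l)) P"
      by (rule back_subst[of "\<lambda>s. wp ?c s P", OF IH]) (use d True in \<open>auto simp: fun_eq_iff g_def\<close>)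
    then show ?thesis using True by (auto intro: wp_Skip)
  next
    case False
    have "wp (Push flag Void) (s(a := l)) (\<lambda>s'. wp ?c s' P)"
      by (rule wp_Push, rule back_subst[of "\<lambda>s. wp ?c s P", OF IH])
        (use d False in \<open>auto simp: fun_eq_iff g_def\<close>)
    then show ?thesis using False by simp
  qed
  show ?case by (rule wp_Drain_Cons, rule l, rule *)
qed

text \<open>The right-hand side is what \<open>compare\<close> tests. As \<open>t\<close> contains
  no \<open>Void\<close>, its symbols cannot be matched by positions beyond the end of
  \<open>a\<close>.\<close>

lemma nth_void_eq_iff:
  assumes "Void \<notin> set t"
  shows "(\<forall>n. nth_void a n = nth_void t n) \<longleftrightarrow>
    take (length t) a = t \<and> set (drop (length t) a) \<subseteq> {Void}"
  using assms
proof (induction t arbitrary: a)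
  case Nil
  show ?case
    by (auto simp: nth_void_def set_conv_nth)
next
  case (Cons e t)
  show ?case
  proof (cases a)
    case Nil
    then have "nth_void a 0 \<noteq> nth_void (e # t) 0" using Cons.prems by auto
    then show ?thesis using Nil by (metis list.discI take_Nil)
  next
    case (Cons e' a')
    have "(\<forall>n. nth_void a n = nth_void (e # t) n) \<longleftrightarrow> e' = e \<and> (\<forall>n. nth_void a' n = nth_void t n)"
      unfolding Cons by (metis nth_void_simps(2,3) not0_implies_Suc)
    then show ?thesis using Cons.IH[of a'] \<open>Void \<notin> set (e # t)\<close> Cons by simp
  qed
qed

lemma wp_compare:
  fixes s :: "('k, 's work_symbol) store"
  assumes d: "distinct [a, t, temp, flag]" and temp: "s temp = []" and t: "Void \<notin> set (s t)"
    and P: "\<And>f :: 's work_symbol list. (f = [] \<longleftrightarrow> (\<forall>n. nth_void (s a) n = nth_void (s t) n)) \<Longrightarrow>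
      P (s(a := [], flag := f @ s flag))"
  shows "wp (compare temp flag a t) s P"
  unfolding compare_def
proof (rule wp_Seq, rule wp_compare_prefix[OF d], rule wp_Seq)
  fix f :: "'s work_symbol list" assume f: "f = [] \<longleftrightarrow> take (length (s t)) (s a) = s t"
  let ?s = "s(t := [], temp := rev (s t) @ s temp, a := drop (length (s t)) (s a), flag := f @ s flag)"
  show "wp (Drain a (\<lambda>e. if e = Void then Skip else Push flag Void)) ?s
      (\<lambda>s'. wp (move_stack temp t) s' P)"
  proof (rule wp_compare_rest)
    show "a \<noteq> flag" using d by simp
    fix g :: "'s work_symbol list" assume g: "g = [] \<longleftrightarrow> set (?s a) \<subseteq> {Void}"
    have *: "P (s(a := [], flag := (g @ f) @ s flag))"
      by (rule P) (use f g d nth_void_eq_iff[OF t, of "s a"] in auto)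
    show "wp (move_stack temp t) (?s(a := [], flag := g @ ?s flag)) P"
      by (rule wp_move_stack, use d in force, rule back_subst[of P, OF *])
        (use d temp in \<open>auto simp: fun_eq_iff\<close>)
  qed
qed

lemma represents_eq_iff:
  assumes "represents h w l r" "represents h w' l' r'"
  shows "w = w' \<longleftrightarrow> (\<forall>n. nth_void l n = nth_void l' n) \<and> (\<forall>n. nth_void r n = nth_void r' n)"
proof
  assume "w = w'"
  then show "(\<forall>n. nth_void l n = nth_void l' n) \<and> (\<forall>n. nth_void r n = nth_void r' n)"
    using assms unfolding represents_def by metis
next
  assume eq: "(\<forall>n. nth_void l n = nth_void l' n) \<and> (\<forall>n. nth_void r n = nth_void r' n)"
  show "w = w'"
  proof
    fix i
    have "i = h + int (nat (i - h)) \<or> i = h - 1 - int (nat (h - 1 - i))" by linarith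
    then show "w i = w' i" using assms eq unfolding represents_def by metis
  qed
qed

section \<open>Advancing, testing and searching candidates\<close>

locale search = enumeration "insert Void (range Sym) :: 's::finite work_symbol set" ix b
  for ix b +
  fixes M F :: "'s machine"
begin

text \<open>Increment with carry. A digit that overflows is replaced by the lowest one on
  \<open>Temp\<close>, and \<open>Flag\<close> is refilled to continue with the next digit.\<close>

definition advance_step :: "(track, 's work_symbol) com" where
  "advance_step = Pop Code (\<lambda>v. case v of None \<Rightarrow> Push Code (el 0)
     | Some e \<Rightarrow> if Suc (ix e) < b then Push Code (el (Suc (ix e)))
         else Seq (Push Temp (el 0)) (Push Flag Void))"

definition advance :: "(track, 's work_symbol) com" where
  "advance = Seq (Push Flag Void) (Seq (Drain Flag (\<lambda>_. advance_step)) (move_stack Temp Code))"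

lemma wp_advance_loop:
  assumes "s Flag = [Void]"
    and "\<And>d c. successor (s Code) = rev d @ c \<Longrightarrow> P (s(Flag := [], Code := c, Temp := d @ s Temp))"
  shows "wp (Drain Flag (\<lambda>_. advance_step)) s P"
  using assms
proof (induction "s Code" arbitrary: s)
  case Nil
  have *: "P (s(Flag := [], Code := [el 0], Temp := [] @ s Temp))"
    by (rule Nil.prems) (simp add: Nil.hyps[symmetric])
  have "wp advance_step (s(Flag := [])) (\<lambda>s'. wp (Drain Flag (\<lambda>_. advance_step)) s' P)"
    unfolding advance_step_def
    by (rule wp_Pop, simp add: Nil.hyps[symmetric], rule wp_Push, rule wp_Drain_Nil, simp,
        rule back_subst[of P, OF *]) (use Nil.hyps in \<open>auto simp: fun_eq_iff\<close>)
  with Nil.prems(1) show ?case by (rule wp_Drain_Cons)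
next
  case (Cons e c)
  note c = Cons.hyps(2)[symmetric]
  have "wp advance_step (s(Flag := [])) (\<lambda>s'. wp (Drain Flag (\<lambda>_. advance_step)) s' P)"
  proof (cases "Suc (ix e) < b")
    case True
    have *: "P (s(Flag := [], Code := el (Suc (ix e)) # c, Temp := [] @ s Temp))"
      by (rule Cons.prems) (simp add: c True)
    show ?thesis
      unfolding advance_step_def
      by (rule wp_Pop, simp add: c True, rule wp_Push, rule wp_Drain_Nil, simp,
        rule back_subst[of P, OF *]) (use c in \<open>auto simp: fun_eq_iff\<close>)
  next
    case False
    let ?s = "s(Code := c, Temp := el 0 # s Temp)"
    have IH: "wp (Drain Flag (\<lambda>_. advance_step)) ?s P"
    proof (rule Cons.hyps(1))
      show "?s Flag = [Void]" using Cons.prems(1) by simp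
      fix d c' assume d: "successor (?s Code) = rev d @ c'"
      have *: "P (s(Flag := [], Code := c', Temp := (d @ [el 0]) @ s Temp))"
        by (rule Cons.prems) (use d c False in simp)
      show "P (?s(Flag := [], Code := c', Temp := d @ ?s Temp))"
        by (rule back_subst[of P, OF *]) (auto simp: fun_eq_iff)
    qed simp
    show ?thesis
      unfolding advance_step_def
      by (rule wp_Pop, simp add: c False, rule wp_Seq, rule wp_Push, rule wp_Push,
        fold advance_step_def, rule back_subst[of "\<lambda>s. wp _ s P", OF IH])
        (use Cons.prems(1) in \<open>auto simp: fun_eq_iff\<close>)
  qed
  with Cons.prems(1) show ?case by (rule wp_Drain_Cons)
qed

lemma wp_advance:
  assumes "s Flag = []" "s Temp = []" and P: "P (s(Code := successor (s Code)))"
  shows "wp advance s P"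
  unfolding advance_def
proof (rule wp_Seq, rule wp_Push, rule wp_Seq, rule wp_advance_loop)
  let ?s = "s(Flag := Void # s Flag)"
  show "?s Flag = [Void]" using assms by simp
  fix d c assume d: "successor (?s Code) = rev d @ c"
  show "wp (move_stack Temp Code) (?s(Flag := [], Code := c, Temp := d @ ?s Temp)) P"
    by (rule wp_move_stack, simp, rule back_subst[of P, OF P])
      (use d assms in \<open>auto simp: fun_eq_iff\<close>)
qed

text \<open>The bounded simulation has destroyed the decoded tape, so the candidate is decoded anew;
  the clock filled on that occasion is discarded, because \<open>F\<close> runs unbounded.\<close>

definition check :: "(track, 's work_symbol) com" where
  "check = Seq decode_prog (Seq (clear Clock) (Seq (Push State (Aux 0)) (Seq (sim_run F)
     (Seq (compare Temp Flag WorkL SaveL) (Seq (compare Temp Flag WorkR SaveR)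
       (Pop Flag (\<lambda>v. case v of None \<Rightarrow> Skip | Some _ \<Rightarrow> Seq (clear Flag) (Push Again Void))))))))"

text \<open>Advancing comes before testing, so the empty list is never tested; nothing is lost,
  since its bound 0 never suffices.\<close>

definition try_next :: "(track, 's work_symbol) com" where
  "try_next = Seq advance (Seq decode_prog (Seq (Push State (Aux 0)) (Seq (sim_bounded M)
     (Seq (clear WorkL) (Seq (clear WorkR)
       (Pop State (\<lambda>v. case v of None \<Rightarrow> check | Some _ \<Rightarrow> Push Again Void)))))))"

definition search_prog :: "(track, 's work_symbol) com" where
  "search_prog = Seq (move_stack InR SaveR) (Seq (move_stack InL SaveL) (Seq (Push Again Void)
     (Seq (Drain Again (\<lambda>_. try_next)) (Seq decode_prog (Seq (clear Clock) (Seq (clear Code)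
       (Seq (clear SaveL) (Seq (clear SaveR)
         (Seq (move_stack WorkL InL) (move_stack WorkR InR))))))))))"

text \<open>The loop invariant: between two rounds every stack not listed is empty.\<close>

definition searching where
  "searching L R c g = (\<lambda>_. [])(SaveL := L, SaveR := R, Code := c, Again := g)"

lemma wp_check:
  assumes t: "load t = tape_of L R" "set L \<subseteq> range Sym" "set R \<subseteq> range Sym"
    and F: "outputs F (decode c) u"
    and P: "P (searching L R c (if u = t then [] else [Void]))"
  shows "wp check (searching L R c []) P"
proof -
  let ?s = "(searching L R c [])(WorkL := left_half c, WorkR := right_half c, State := [Aux 0])"
  let ?tail = "Pop Flag (\<lambda>v. case v of None \<Rightarrow> Skip | Some _ \<Rightarrow> Seq (clear Flag) (Push Again Void))"
  let ?rest = "Seq (compare Temp Flag WorkL SaveL) (Seq (compare Temp Flag WorkR SaveR) ?tail)"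
  obtain q where halts: "halts_in F (0, 0, load (decode c)) (q, 0, load u)"
    using F unfolding outputs_def by blast
  have Void: "Void \<notin> set L" "Void \<notin> set R" using t by auto
  have "wp (sim_run F) ?s (\<lambda>s. wp ?rest s P)"
  proof (rule wp_sim_run[OF halts])
    show "represents 0 (load (decode c)) (?s WorkL) (?s WorkR)"
      using represents_tape_of[of "left_half c" "right_half c"] by (simp add: load_decode)
    fix l r assume "represents 0 (load u) l r"
    then have eq: "u = t \<longleftrightarrow> (\<forall>n. nth_void l n = nth_void L n) \<and> (\<forall>n. nth_void r n = nth_void R n)"
      using represents_eq_iff[OF _ represents_tape_of, of "load u" l r L R]
      by (simp add: t(1)[symmetric] load_inject)
    let ?s1 = "?s(WorkL := l, WorkR := r, State := [])"
    show "wp ?rest ?s1 P"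
    proof (rule wp_Seq, rule wp_compare, simp, simp add: searching_def,
        simp add: searching_def Void, rule wp_Seq, rule wp_compare, simp, simp add: searching_def,
        simp add: searching_def Void)
      fix f g :: "'s work_symbol list"
      let ?s2 = "?s1(WorkL := [], Flag := f @ ?s1 Flag)"
      assume f: "f = [] \<longleftrightarrow> (\<forall>n. nth_void (?s1 WorkL) n = nth_void (?s1 SaveL) n)"
        and g: "g = [] \<longleftrightarrow> (\<forall>n. nth_void (?s2 WorkR) n = nth_void (?s2 SaveR) n)"
      have fg: "g @ f = [] \<longleftrightarrow> u = t"
        using f g unfolding eq by (auto simp: searching_def)
      have s3: "?s2(WorkR := [], Flag := g @ ?s2 Flag) = (searching L R c [])(Flag := g @ f)"
        by (auto simp: fun_eq_iff searching_def)
      show "wp ?tail (?s2(WorkR := [], Flag := g @ ?s2 Flag)) P"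
        unfolding s3
      proof (cases "g @ f")
        case Nil
        then have "u = t" using fg by simp
        then have *: "P (searching L R c [])" using P by simp
        show "wp ?tail ((searching L R c [])(Flag := g @ f)) P"
          by (rule wp_Pop, simp add: Nil, rule wp_Skip, rule back_subst[of P, OF *])
            (auto simp: fun_eq_iff searching_def)
      next
        case (Cons e k)
        then have "u \<noteq> t" using fg by auto
        then have *: "P (searching L R c [Void])" using P by simp
        show "wp ?tail ((searching L R c [])(Flag := g @ f)) P"
          by (rule wp_Pop, simp add: Cons, rule wp_Seq, rule wp_clear, rule wp_Push,
              rule back_subst[of P, OF *])
            (auto simp: fun_eq_iff searching_def)
      qed
    qed
  qed simp
  then have *: "wp (Seq (sim_run F) ?rest) ?s P" by (rule wp_Seq)
  show ?thesis unfolding check_def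
    by (rule wp_Seq, rule wp_decode_prog, simp add: searching_def, simp add: searching_def,
        simp add: searching_def, rule wp_Seq, rule wp_clear, rule wp_Seq, rule wp_Push,
        rule back_subst[of "\<lambda>s. wp _ s P", OF *]) (auto simp: fun_eq_iff searching_def)
qed

text \<open>The assumption on \<open>F\<close> is conditional on acceptance by \<open>M\<close>: on
  other tapes \<open>F\<close> need not halt, and \<open>check\<close> is not reached.\<close>

lemma wp_try_next:
  assumes t: "load t = tape_of L R" "set L \<subseteq> range Sym" "set R \<subseteq> range Sym"
    and d: "d = successor c"
    and F: "halts_within M (length d) (0, 0, load (decode d)) \<Longrightarrow> outputs F (decode d) (f (decode d))"
    and P: "P (searching L R d (if halts_within M (length d) (0, 0, load (decode d))
      \<and> f (decode d) = t then [] else [Void]))"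
  shows "wp try_next (searching L R c []) P"
proof -
  let ?s = "(searching L R d [])(Clock := d, WorkL := left_half d, WorkR := right_half d, State := [Aux 0])"
  let ?tail = "Pop State (\<lambda>v. case v of None \<Rightarrow> check | Some _ \<Rightarrow> Push Again Void)"
  let ?rest = "Seq (clear WorkL) (Seq (clear WorkR) ?tail)"
  let ?h = "halts_within M (length d) (0, 0, load (decode d))"
  have "wp (sim_bounded M) ?s (\<lambda>s. wp ?rest s P)"
  proof (rule wp_sim_bounded)
    show "represents 0 (load (decode d)) (?s WorkL) (?s WorkR)"
      using represents_tape_of[of "left_half d" "right_half d"] by (simp add: load_decode)
    show "?s State = [Aux 0]" by simp
    fix l r q
    let ?k = "if halts_within M (length (?s Clock)) (0, 0, load (decode d)) then [] else [Aux q]"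
    let ?s1 = "?s(Clock := [], WorkL := l, WorkR := r, State := ?k)"
    have k: "?k = (if ?h then [] else [Aux q])" by simp
    have s2: "?s1(WorkL := [], WorkR := []) = (searching L R d [])(State := if ?h then [] else [Aux q])"
      by (auto simp: fun_eq_iff searching_def)
    have "wp ?tail (?s1(WorkL := [], WorkR := [])) P"
      unfolding s2
    proof (cases ?h)
      case True
      then have "wp check (searching L R d []) P" using wp_check[OF t F] P by simp
      then show "wp ?tail ((searching L R d [])(State := if ?h then [] else [Aux q])) P"
        using True by (intro wp_Pop) (auto simp: searching_def elim!: back_subst[of "\<lambda>s. wp _ s P"])
    next
      case False
      then have *: "P (searching L R d [Void])" using P by simp
      show "wp ?tail ((searching L R d [])(State := if ?h then [] else [Aux q])) P"
        by (rule wp_Pop, simp add: False, rule wp_Push, rule back_subst[of P, OF *])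
          (auto simp: fun_eq_iff searching_def)
    qed
    then show "wp ?rest ?s1 P" by (intro wp_Seq wp_clear)
  qed
  then have *: "wp (Seq (sim_bounded M) ?rest) ?s P" by (rule wp_Seq)
  show ?thesis unfolding try_next_def
    by (rule wp_Seq, rule wp_advance, simp add: searching_def, simp add: searching_def,
        rule wp_Seq, rule wp_decode_prog, simp add: searching_def, simp add: searching_def,
        simp add: searching_def, rule wp_Seq, rule wp_Push,
        rule back_subst[of "\<lambda>s. wp _ s P", OF *]) (auto simp: fun_eq_iff searching_def d)
qed

lemma wp_again:
  assumes "wp try_next (searching L R c []) (\<lambda>s. wp (Drain Again (\<lambda>_. try_next)) s P)"
  shows "wp (Drain Again (\<lambda>_. try_next)) (searching L R c [Void]) P"
proof (rule wp_Drain_Cons)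
  show "searching L R c [Void] Again = Void # []" by (simp add: searching_def)
  have "(searching L R c [Void])(Again := []) = searching L R c []"
    by (auto simp: fun_eq_iff searching_def)
  with assms show "wp try_next ((searching L R c [Void])(Again := []))
      (\<lambda>s. wp (Drain Again (\<lambda>_. try_next)) s P)" by simp
qed

text \<open>Induction on the number of rounds until a known successful candidate. The loop may stop
  at an earlier one, so \<open>P\<close> has to hold for every successful candidate.\<close>

lemma wp_search_loop:
  assumes t: "load t = tape_of L R" "set L \<subseteq> range Sym" "set R \<subseteq> range Sym"
    and F: "\<And>d. halts_within M (length d) (0, 0, load (decode d)) \<Longrightarrow> outputs F (decode d) (f (decode d))"
    and found: "d = (successor ^^ Suc n) c" "halts_within M (length d) (0, 0, load (decode d))"
      "f (decode d) = t"
    and P: "\<And>d. halts_within M (length d) (0, 0, load (decode d)) \<Longrightarrow> f (decode d) = t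
      \<Longrightarrow> P (searching L R d [])"
  shows "wp (Drain Again (\<lambda>_. try_next)) (searching L R c [Void]) P"
  using found
proof (induction n arbitrary: c)
  case (0 c)
  show ?case
  proof (rule wp_again, rule wp_try_next[OF t refl])
    show "wp (Drain Again (\<lambda>_. try_next)) (searching L R (successor c)
      (if halts_within M (length (successor c)) (0, 0, load (decode (successor c)))
        \<and> f (decode (successor c)) = t then [] else [Void])) P"
      using 0 P by (intro wp_Drain_Nil) (auto simp: searching_def)
  qed (rule F)
next
  case (Suc n c)
  show ?case
  proof (rule wp_again, rule wp_try_next[OF t refl])
    let ?d = "successor c"
    show "wp (Drain Again (\<lambda>_. try_next)) (searching L R ?d
      (if halts_within M (length ?d) (0, 0, load (decode ?d)) \<and> f (decode ?d) = t then [] else [Void])) P"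
    proof (cases "halts_within M (length ?d) (0, 0, load (decode ?d)) \<and> f (decode ?d) = t")
      case True
      then have "P (searching L R ?d [])" using P by blast
      then show ?thesis using True by (intro wp_Drain_Nil) (auto simp: searching_def)
    next
      case False
      have "wp (Drain Again (\<lambda>_. try_next)) (searching L R ?d [Void]) P"
        by (rule Suc.IH) (use Suc.prems in \<open>simp_all add: funpow_swap1\<close>)
      then show ?thesis using False by auto
    qed
  qed (rule F)
qed

lemma wp_search_prog:
  assumes t: "load t = tape_of L R" "set L \<subseteq> range Sym" "set R \<subseteq> range Sym"
    and F: "\<And>d. halts_within M (length d) (0, 0, load (decode d)) \<Longrightarrow> outputs F (decode d) (f (decode d))"
    and found: "halts_in M (0, 0, load x) cfg" "f x = t"
  shows "\<exists>d. halts_within M (length d) (0, 0, load (decode d)) \<and> f (decode d) = t \<and>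
    exec search_prog (io Main L R) (io Main (left_half d) (right_half d))"
proof -
  obtain n where n: "\<forall>k\<ge>n. halts_within M k (0, 0, load x)"
    using halts_in_within[OF found(1)] by blast
  \<comment> \<open>Length \<open>n\<close> gives \<open>M\<close> enough time; the extra 1 makes
    \<open>d\<close> non-empty, so that it is reached from the empty list by at least one
    advance.\<close>
  obtain d where d: "set d \<subseteq> insert Void (range Sym)" "Suc n \<le> length d" "decode d = x"
    using decode_surj[of "Suc n" x] by blast
  obtain e d' where "d = e # d'" using d(2) by (cases d) auto
  then obtain m where m: "val d = Suc m" by simp
  have found': "d = (successor ^^ Suc m) []"
    using successor_reaches[of d] d(1) m by (auto simp: in_lists_conv_set subset_iff)
  let ?Q = "\<lambda>s. \<exists>d. halts_within M (length d) (0, 0, load (decode d)) \<and> f (decode d) = t \<and>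
    s = io Main (left_half d) (right_half d)"
  let ?rest = "Seq decode_prog (Seq (clear Clock) (Seq (clear Code)
       (Seq (clear SaveL) (Seq (clear SaveR)
         (Seq (move_stack WorkL InL) (move_stack WorkR InR))))))"
  have "wp (Drain Again (\<lambda>_. try_next)) (searching L R [] [Void]) (\<lambda>s. wp ?rest s ?Q)"
  proof (rule wp_search_loop[OF t F found'])
    show "halts_within M (length d) (0, 0, load (decode d))" "f (decode d) = t"
      using d n found(2) by auto
    fix c assume c: "halts_within M (length c) (0, 0, load (decode c))" "f (decode c) = t"
    have *: "?Q (io Main (left_half c) (right_half c))" using c by blast
    show "wp ?rest (searching L R c []) ?Q"
      by (rule wp_Seq, rule wp_decode_prog, simp add: searching_def, simp add: searching_def,
        simp add: searching_def, (rule wp_Seq, rule wp_clear)+, rule wp_Seq,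
        rule wp_move_stack, simp, rule wp_move_stack, simp, rule back_subst[of ?Q, OF *])
        (auto simp: fun_eq_iff searching_def io_def)
  qed
  then have *: "wp (Seq (Drain Again (\<lambda>_. try_next)) ?rest) (searching L R [] [Void]) ?Q"
    by (rule wp_Seq)
  have "wp search_prog (io Main L R) ?Q"
    unfolding search_prog_def
    by (rule wp_Seq, rule wp_move_stack, simp, rule wp_Seq, rule wp_move_stack, simp,
        rule wp_Seq, rule wp_Push, rule back_subst[of "\<lambda>s. wp _ s ?Q", OF *])
      (auto simp: fun_eq_iff searching_def io_def)
  then show ?thesis unfolding wp_def by blast
qed

text \<open>A simulated move stores both the written symbol and the target state on stacks, whence
  the closure condition \<open>table\<close>; \<open>Aux 0\<close> is the start state, and
  \<open>Void\<close> serves as blank and as marker.\<close>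

lemma pushes_in_search_prog:
  assumes sym: "Void \<in> E" "range Sym \<subseteq> E" "Aux 0 \<in> E"
    and table: "\<And>T q a q' c d. T \<in> {M, F} \<Longrightarrow> T (q, a) = Some (q', c, d) \<Longrightarrow> c \<in> E \<and> Aux q' \<in> E"
  shows "pushes_in E search_prog"
proof -
  have Sym: "Sym a \<in> E" for a using sym by auto
  have el: "el i \<in> E" if "i < b" for i using el_in[OF that] sym by auto
  have move: "pushes_in E (move_stack k k')" for k k' :: "track \<times> bool"
    by (simp add: move_stack_def)
  have clear: "pushes_in E (clear k)" for k :: "track \<times> bool"
    by (simp add: clear_def)
  have or_void: "or_void v \<in> E" if "v \<in> insert None (Some ` E)" for v
    using that sym by (auto simp: or_void_def)
  have step: "pushes_in E (sim_step T e)" if "T \<in> {M, F}" for T e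
  proof (cases e)
    case (Aux q)
    have "pushes_in E (case T (q, or_void v) of
        None \<Rightarrow> Push WorkR (or_void v)
      | Some (q', b, d) \<Rightarrow> Seq (Push State (Aux q')) (case d of
            Stay \<Rightarrow> Push WorkR b
          | MoveRight \<Rightarrow> Push WorkL b
          | MoveLeft \<Rightarrow> Seq (Push WorkR b) (Pop WorkL (\<lambda>u. Push WorkR (or_void u)))))"
      if "v \<in> insert None (Some ` E)" for v
    proof (cases "T (q, or_void v)")
      case None
      then show ?thesis using or_void[OF that] by simp
    next
      case (Some z)
      obtain q' c d where z: "z = (q', c, d)" by (cases z)
      then show ?thesis using table[OF \<open>T \<in> {M, F}\<close> Some[unfolded z]] Some or_void
        by (cases d) auto
    qed
    then show ?thesis unfolding sim_step_def Aux by (simp only: pushes_in.simps work_symbol.case) blast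
  qed (auto simp: sim_step_def)
  have bounded: "pushes_in E (sim_bounded M)"
    using step by (auto simp: sim_bounded_def)
  have run: "pushes_in E (sim_run F)"
    using step by (auto simp: sim_run_def)
  have compare: "pushes_in E (compare temp flag k k')" for temp flag k k' :: "track \<times> bool"
    using sym move by (auto simp: compare_def)
  have trimmed: "pushes_in E (push_trimmed k e)" if "e \<in> E" for k :: "track \<times> bool" and e
    using that sym by (auto simp: push_trimmed_def)
  have place: "pushes_in E (place_prog e)" if "e \<in> E" for e
    using that Sym by (cases e) (auto simp: place_prog_def intro!: trimmed)
  have decode: "pushes_in E decode_prog"
    using place Sym move by (auto simp: decode_prog_def)
  have advance: "pushes_in E advance"
    using sym el b_pos move by (auto simp: advance_def advance_step_def)
  show ?thesis
    using move clear bounded run compare decode advance sym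
    by (simp add: search_prog_def try_next_def check_def)
qed

end

section \<open>The search applied to the machines for \<open>f\<close> and for the enumerable
  image\<close>

theorem theorem6:
  fixes A :: "'a set"
    and x y :: "'a \<Rightarrow> 's::finite tape"
    and f :: "'s tape \<Rightarrow> 's tape"
    and pr :: "'s tape \<times> 's tape \<Rightarrow> 's tape"
  assumes "tape_pairing pr"
    and "countable A"
    and "representation A x"
    and "representation A y"
    and "computable_on (x ` A) f"
    and "f ` (x ` A) = y ` A"
    and "\<forall>a\<in>A. y a = f (x a)"
    and "comp_enumerable (x ` A)"
  shows "(\<exists>g. computable_on (y ` A) g \<and> (\<forall>a\<in>A. x a = g (y a)))
         \<and> transf_equivalent A x y"
proof -
  have inj: "inj_on x A" "inj_on y A" using assms(3,4) by (auto simp: representation_def)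
  obtain F where F: "turing_machine F" "\<And>t. t \<in> x ` A \<Longrightarrow> outputs F t (f t)"
    using assms(5) unfolding computable_on_def by blast
  obtain M yes where M: "turing_machine M" "\<And>t. t \<in> x ` A \<Longrightarrow> outputs M t yes"
      "\<And>t. t \<notin> x ` A \<Longrightarrow> \<not> halts_on M t"
    using assms(8) unfolding comp_enumerable_def by blast
  define S :: "'s work_symbol set" where "S = insert Void (range Sym)"
  have finS: "finite S" by (simp add: S_def)
  then obtain ix where ix: "bij_betw ix S {0..<card S}"
    using ex_bij_betw_finite_nat by blast
  have "card S > 0" using finS by (auto simp: S_def card_gt_0_iff)
  interpret search ix "card S" M F
    by unfold_locales (use ix \<open>card S > 0\<close> in \<open>simp_all add: S_def atLeast0LessThan\<close>)
  \<comment> \<open>The finite alphabet of the search: the candidate symbols together with all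
    symbols written and all states entered by the two machines.\<close>
  define E where "E = insert (Aux 0) S \<union> (\<lambda>(q, c, d). c) ` (ran M \<union> ran F)
    \<union> (\<lambda>(q, c, d). Aux q) ` (ran M \<union> ran F)"
  have "finite (ran M)" "finite (ran F)"
    using M(1) F(1) by (auto simp: turing_machine_def intro: finite_ran)
  then have finE: "finite E" using finS by (simp add: E_def)
  have pushes: "pushes_in E search_prog"
  proof (rule pushes_in_search_prog)
    fix T q a q' c d assume "T \<in> {M, F}" "T (q, a) = Some (q', c, d)"
    then have "(q', c, d) \<in> ran M \<union> ran F" by (auto intro: ranI)
    then show "c \<in> E \<and> Aux q' \<in> E" unfolding E_def by force
  qed (auto simp: E_def S_def)
  have SymE: "range Sym \<subseteq> E" by (auto simp: E_def S_def)
  obtain T where T: "turing_machine T"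
    "\<And>t t' L R L' R'. \<lbrakk>load t = tape_of L R; set L \<subseteq> range Sym; set R \<subseteq> range Sym;
      load t' = tape_of L' R'; set L' \<subseteq> range Sym; set R' \<subseteq> range Sym;
      exec search_prog (io Main L R) (io Main L' R')\<rbrakk> \<Longrightarrow> outputs T t t'"
    using stack_program_machine[OF finE SymE pushes, where main = Main] by blast
  have accepted: "decode d \<in> x ` A" if "halts_within M (length d) (0, 0, load (decode d))" for d
    using halts_withinD[OF that] M(3) unfolding halts_on_def by blast
  have T_out: "outputs T (y a) (x a)" if a: "a \<in> A" for a
  proof -
    \<comment> \<open>Any code will do; it only supplies two lists describing the loaded input
      tape.\<close>
    obtain c where c: "decode c = y a" using decode_surj[of 0 "y a"] by blast
    obtain q where "halts_in M (0, 0, load (x a)) (q, 0, load yes)"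
      using M(2)[of "x a"] a unfolding outputs_def by blast
    then obtain d where d: "halts_within M (length d) (0, 0, load (decode d))" "f (decode d) = y a"
      "exec search_prog (io Main (left_half c) (right_half c)) (io Main (left_half d) (right_half d))"
      using wp_search_prog[of "y a" "left_half c" "right_half c" f "x a"]
        load_decode[of c] c set_left_half set_right_half F(2) accepted assms(7) a by metis
    obtain a' where a': "a' \<in> A" "decode d = x a'" using accepted[OF d(1)] by blast
    \<comment> \<open>The search may have stopped at a candidate other than the expected one, but
      \<open>y a' = f (x a') = y a\<close>, and \<open>y\<close> is injective on
      \<open>A\<close>.\<close>
    then have "a' = a" using d(2) assms(7) inj(2) a by (metis inj_onD)
    then have "load (x a) = tape_of (left_half d) (right_half d)" using a' load_decode[of d] by simp
    then show ?thesis
      using T(2)[OF _ set_left_half set_right_half _ set_left_half set_right_half d(3)]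
        load_decode[of c] c by simp
  qed
  have "computable_on (y ` A) (x \<circ> inv_into A y)"
    using T(1) T_out inj(2) unfolding computable_on_def by (intro exI[of _ T]) auto
  moreover have "\<forall>a\<in>A. x a = (x \<circ> inv_into A y) (y a)" using inj(2) by simp
  \<comment> \<open>On the image of \<open>A\<close> under \<open>x\<close> this function agrees
    with \<open>f\<close>, so \<open>F\<close> computes it.\<close>
  moreover have "computable_on (x ` A) (y \<circ> inv_into A x)"
    using F inj(1) assms(7) unfolding computable_on_def by (intro exI[of _ F]) auto
  ultimately show ?thesis unfolding transf_equivalent_def transformable_def by blast
qed

end
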